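(* Let $\omega$ be a weight function and let $\psi(x):=ax$ for all $x\in\mathbb{R}$, with $a\in\mathbb{R}$, $a\neq 0$. Suppose that $\omega$ satisfies the condition $$(\zeta)\qquad \exists H\geq 1:\ 2\omega(t)\leq \omega(Ht)+H \quad \forall t\geq 0.$$ Then the following conditions are equivalent: (1) $C_\psi\colon \mathcal{S}_\omega(\mathbb{R})\to \mathcal{S}_\omega(\mathbb{R})$ is power bounded. (2) $C_\psi\colon \mathcal{S}_\omega(\mathbb{R})\to \mathcal{S}_\omega(\mathbb{R})$ is $m$-topologizable. (3) $C_\psi\colon \mathcal{S}_\omega(\mathbb{R})\to \mathcal{S}_\omega(\mathbb{R})$ is topologizable. (4) The family $\{C_{\psi_m}: \mathcal{S}_{\omega}(\mathbb{R})\to \mathcal{S}(\mathbb{R}): m\in\mathbb{N}\}$ is equicontinuous, where $\mathcal{S}(\mathbb{R})$ is the Schwartz space of rapidly decreasing smooth functions. (5) $a=\pm 1$.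
   Context: A weight function is a continuous increasing function $\omega:[0,\infty)\to[0,\infty)$ such that: $(\alpha)$ there is $L\ge 1$ with $\omega(2t)\le L(\omega(t)+1)$ for all $t\ge 0$; $(\beta)$ $\int_0^\infty \frac{\omega(t)}{1+t^2}\,dt<\infty$; $(\gamma)$ $\log(1+t^2)=o(\omega(t))$ as $t\to\infty$; $(\delta)$ $\varphi_\omega(t):=\omega(e^t)$ is convex. The Young conjugate is $\varphi_\omega^*(s):=\sup\{st-\varphi_\omega(t): t\ge 0\}$, $s\ge 0$. The space $\mathcal{S}_\omega(\mathbb{R})$ consists of all $f\in C^\infty(\mathbb{R})$ such that for every $\lambda>0$ $$p_{\omega,\lambda}(f):=\sup_{x\in\mathbb{R}}\sup_{n,q\in\mathbb{N}_0}(1+|x|)^q|f^{(n)}(x)|\exp\left(-\lambda\varphi_\omega^*\left(\tfrac{n+q}{\lambda}\right)\right)<\infty,$$ with the Fréchet topology given by the system of seminorms $\{p_{\omega,\lambda}:\lambda>0\}$. For $\psi:\mathbb{R}\to\mathbb{R}$, $\psi_m=\psi\circ\cdots\circ\psi$ ($m$ times), and $C_{\psi_m}f:=f\circ\psi_m$, so $C_{\psi_m}=(C_\psi)^m$. Let $T$ be a continuous linear operator on a locally convex Hausdorff space $E$ whose topology is determined by a system of continuous seminorms $cs(E)$ (here $\{p_{\omega,\lambda}:\lambda>0\}$). $T$ is power bounded if $(T^k)_{k\in\mathbb{N}}$ is equicontinuous. $T$ is topologizable if for every $p\in cs(E)$ there is $q\in cs(E)$ such that for every $k\in\mathbb{N}$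 there is $M_k>0$ with $p(T^kx)\le M_k\,q(x)$ for all $x\in E$. $T$ is $m$-topologizable if for every $p\in cs(E)$ there are $q\in cs(E)$ and $C\ge 1$ with $p(T^kx)\le C^k\,q(x)$ for all $k\in\mathbb{N}$, $x\in E$. *)

theory Defs
  imports "HOL-Analysis.Analysis" "HOL-Library.Landau_Symbols"
begin

section \<open>Weight functions\<close>

text \<open>
  A weight function lives on \<open>[0,\<infinity>)\<close>; it is modelled by a total function on the reals of which
  only the values on \<open>{0..}\<close> are constrained. ``Increasing'' is meant in the weak sense, so that
  for instance weights vanishing on \<open>[0,1]\<close> are allowed.
\<close>

definition weight_function :: "(real \<Rightarrow> real) \<Rightarrow> bool" where
  "weight_function \<omega> \<longleftrightarrow>
     continuous_on {0..} \<omega> \<and> mono_on {0..} \<omega> \<and> (\<forall>t\<ge>0. \<omega> t \<ge> 0) \<and>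
     (\<exists>L\<ge>1. \<forall>t\<ge>0. \<omega> (2 * t) \<le> L * (\<omega> t + 1)) \<and>
     set_integrable lborel {0..} (\<lambda>t. \<omega> t / (1 + t\<^sup>2)) \<and>
     (\<lambda>t. ln (1 + t\<^sup>2)) \<in> o[at_top](\<omega>) \<and>
     convex_on UNIV (\<lambda>t. \<omega> (exp t))"

definition zeta_condition :: "(real \<Rightarrow> real) \<Rightarrow> bool" where
  "zeta_condition \<omega> \<longleftrightarrow> (\<exists>H\<ge>1. \<forall>t\<ge>0. 2 * \<omega> t \<le> \<omega> (H * t) + H)"

text \<open>
  For a weight function and \<open>s \<ge> 0\<close> the supremum is finite, because \<open>ln (1 + t\<^sup>2) = o(\<omega> t)\<close> makes
  \<open>\<omega> (exp t)\<close> grow faster than any multiple of \<open>t\<close>; so the real supremum is the intended one.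
\<close>

definition young_conj :: "(real \<Rightarrow> real) \<Rightarrow> real \<Rightarrow> real" where
  "young_conj \<omega> s = (SUP t\<in>{0..}. s * t - \<omega> (exp t))"


section \<open>The function spaces and their seminorms\<close>

definition nderiv :: "nat \<Rightarrow> (real \<Rightarrow> complex) \<Rightarrow> real \<Rightarrow> complex" where
  "nderiv n = (\<lambda>f x. vector_derivative f (at x)) ^^ n"

definition smooth :: "(real \<Rightarrow> complex) \<Rightarrow> bool" where
  "smooth f \<longleftrightarrow> (\<forall>n x. nderiv n f differentiable (at x))"

definition S_omega_term ::
    "(real \<Rightarrow> real) \<Rightarrow> real \<Rightarrow> (real \<Rightarrow> complex) \<Rightarrow> real \<times> nat \<times> nat \<Rightarrow> real" where
  "S_omega_term \<omega> l f = (\<lambda>(x, n, q).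
     (1 + \<bar>x\<bar>) ^ q * norm (nderiv n f x) * exp (- l * young_conj \<omega> (real (n + q) / l)))"

text \<open>
  The suprema below are real suprema. They are the intended values on the spaces
  \<open>S_omega\<close> and \<open>Schwartz\<close>, whose definitions require the terms to be bounded.
\<close>

definition p_omega :: "(real \<Rightarrow> real) \<Rightarrow> real \<Rightarrow> (real \<Rightarrow> complex) \<Rightarrow> real" where
  "p_omega \<omega> l f = (SUP z. S_omega_term \<omega> l f z)"

definition S_omega :: "(real \<Rightarrow> real) \<Rightarrow> (real \<Rightarrow> complex) set" where
  "S_omega \<omega> = {f. smooth f \<and> (\<forall>l>0. bdd_above (range (S_omega_term \<omega> l f)))}"

definition S_omega_seminorms :: "(real \<Rightarrow> real) \<Rightarrow> ((real \<Rightarrow> complex) \<Rightarrow> real) set" where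
  "S_omega_seminorms \<omega> = {p_omega \<omega> l | l. l > 0}"

definition p_Schwartz :: "nat \<Rightarrow> nat \<Rightarrow> (real \<Rightarrow> complex) \<Rightarrow> real" where
  "p_Schwartz q n f = (SUP x. (1 + \<bar>x\<bar>) ^ q * norm (nderiv n f x))"

definition Schwartz :: "(real \<Rightarrow> complex) set" where
  "Schwartz = {f. smooth f \<and> (\<forall>q n. bdd_above (range (\<lambda>x. (1 + \<bar>x\<bar>) ^ q * norm (nderiv n f x))))}"

definition Schwartz_seminorms :: "((real \<Rightarrow> complex) \<Rightarrow> real) set" where
  "Schwartz_seminorms = {p_Schwartz q n | q n. True}"


section \<open>Operators between spaces of functions topologised by seminorms\<close>

text \<open>
  Below \<open>E\<close>, \<open>F\<close> are linear spaces of functions and \<open>P\<close>, \<open>Q\<close> are systems of seminorms on them.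
  The topology of \<open>(E, P)\<close> has as basic neighbourhoods of \<open>f\<close> the sets
  \<open>{g \<in> E. \<forall>p\<in>P0. p (g - f) < d}\<close> with \<open>P0 \<subseteq> P\<close> finite and \<open>d > 0\<close>.
\<close>

definition linear_into ::
    "(real \<Rightarrow> complex) set \<Rightarrow> (real \<Rightarrow> complex) set \<Rightarrow>
     ((real \<Rightarrow> complex) \<Rightarrow> real \<Rightarrow> complex) \<Rightarrow> bool" where
  "linear_into E F T \<longleftrightarrow>
     T ` E \<subseteq> F \<and>
     (\<forall>f\<in>E. \<forall>g\<in>E. T (\<lambda>x. f x + g x) = (\<lambda>x. T f x + T g x)) \<and>
     (\<forall>c. \<forall>f\<in>E. T (\<lambda>x. c * f x) = (\<lambda>x. c * T f x))"

definition equicontinuous ::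
    "(real \<Rightarrow> complex) set \<Rightarrow> ((real \<Rightarrow> complex) \<Rightarrow> real) set \<Rightarrow> ((real \<Rightarrow> complex) \<Rightarrow> real) set \<Rightarrow>
     ((real \<Rightarrow> complex) \<Rightarrow> real \<Rightarrow> complex) set \<Rightarrow> bool" where
  "equicontinuous E P Q \<T> \<longleftrightarrow>
     (\<forall>f\<in>E. \<forall>q\<in>Q. \<forall>e>0. \<exists>P0\<subseteq>P. finite P0 \<and> (\<exists>d>0. \<forall>T\<in>\<T>. \<forall>g\<in>E.
        (\<forall>p\<in>P0. p (\<lambda>x. g x - f x) < d) \<longrightarrow> q (\<lambda>x. T g x - T f x) < e))"

definition continuous_linear_operator ::
    "(real \<Rightarrow> complex) set \<Rightarrow> ((real \<Rightarrow> complex) \<Rightarrow> real) set \<Rightarrow>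
     ((real \<Rightarrow> complex) \<Rightarrow> real \<Rightarrow> complex) \<Rightarrow> bool" where
  "continuous_linear_operator E P T \<longleftrightarrow> linear_into E E T \<and> equicontinuous E P P {T}"

text \<open>The iterates in the following three notions are indexed by the positive integers.\<close>

definition power_bounded ::
    "(real \<Rightarrow> complex) set \<Rightarrow> ((real \<Rightarrow> complex) \<Rightarrow> real) set \<Rightarrow>
     ((real \<Rightarrow> complex) \<Rightarrow> real \<Rightarrow> complex) \<Rightarrow> bool" where
  "power_bounded E P T \<longleftrightarrow>
     continuous_linear_operator E P T \<and> equicontinuous E P P {T ^^ k | k. k \<ge> 1}"

definition topologizable ::
    "(real \<Rightarrow> complex) set \<Rightarrow> ((real \<Rightarrow> complex) \<Rightarrow> real) set \<Rightarrow>
     ((real \<Rightarrow> complex) \<Rightarrow> real \<Rightarrow> complex) \<Rightarrow> bool" where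
  "topologizable E P T \<longleftrightarrow>
     continuous_linear_operator E P T \<and>
     (\<forall>p\<in>P. \<exists>q\<in>P. \<forall>k\<ge>1. \<exists>M>0. \<forall>f\<in>E. p ((T ^^ k) f) \<le> M * q f)"

definition m_topologizable ::
    "(real \<Rightarrow> complex) set \<Rightarrow> ((real \<Rightarrow> complex) \<Rightarrow> real) set \<Rightarrow>
     ((real \<Rightarrow> complex) \<Rightarrow> real \<Rightarrow> complex) \<Rightarrow> bool" where
  "m_topologizable E P T \<longleftrightarrow>
     continuous_linear_operator E P T \<and>
     (\<forall>p\<in>P. \<exists>q\<in>P. \<exists>C\<ge>1. \<forall>k\<ge>1. \<forall>f\<in>E. p ((T ^^ k) f) \<le> C ^ k * q f)"

definition comp_op :: "(real \<Rightarrow> real) \<Rightarrow> (real \<Rightarrow> complex) \<Rightarrow> real \<Rightarrow> complex" where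
  "comp_op \<psi> f = f \<circ> \<psi>"

end

theory Submission
  imports Defs
begin

text \<open>
  If \<open>a = \<plusminus>1\<close>, every iterate preserves every seminorm. Otherwise the iterates are tested on Gaussians
  \<open>f(x) = exp (-(x - \<eta>)\<^sup>2 + i \<xi> x)\<close>. Their derivatives obey a three-term recursion which gives
  \<open>(1 + \<bar>x\<bar>)\<^sup>q \<bar>f\<^sup>(\<^sup>n\<^sup>)(x)\<bar> \<le> C (8 (N + r))\<^sup>N\<close> with \<open>N = n + q\<close> and \<open>r = \<xi> + \<eta> \<ge> 1\<close>; as
  \<open>\<omega>(t) = o(t)\<close> by \<open>(\<beta>)\<close>, this yields \<open>p\<^sub>\<mu>(f) \<le> C exp (\<kappa> \<omega>(r))\<close>. Conversely, dilating a modulated Gaussian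
  (\<open>\<bar>a\<bar> > 1\<close>, \<open>\<eta> = 0\<close>) or a translated one (\<open>\<bar>a\<bar> < 1\<close>, \<open>\<xi> = 0\<close>) makes \<open>p\<^sub>1\<close> at least
  \<open>exp (\<omega>(\<beta>\<^sup>k r)) / (\<beta>\<^sup>k r)\<close>, where \<open>\<beta> = max \<bar>a\<bar> \<bar>1/a\<bar>\<close>. Since \<open>(\<zeta>)\<close> makes \<open>\<omega>(\<beta>\<^sup>k r)\<close> exceed any
  multiple of \<open>\<omega>(r)\<close> for large \<open>k\<close>, no single seminorm controls all iterates. As maps into
  the Schwartz space, the iterates already fail to be bounded at a single fixed Gaussian.
\<close>

section \<open>Iterated derivatives\<close>

lemma nderiv_0 [simp]: "nderiv 0 f = f"
  by (simp add: nderiv_def)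

lemma nderiv_Suc: "nderiv (Suc n) f = (\<lambda>x. vector_derivative (nderiv n f) (at x))"
  by (simp add: nderiv_def)

lemma smooth_has_vector_derivative:
  assumes "smooth f"
  shows "(nderiv n f has_vector_derivative nderiv (Suc n) f x) (at x)"
  using assms unfolding smooth_def nderiv_Suc by (simp add: vector_derivative_works)

text \<open>Derivatives of all orders are identified by exhibiting a sequence whose members
  differentiate into one another. Multiples, differences, dilations and the Gaussians are all
  treated this way.\<close>

lemma nderiv_eqI:
  assumes "F 0 = f" "\<And>n x. (F n has_vector_derivative F (Suc n) x) (at x)"
  shows "nderiv n f = F n"
proof (induction n)
  case (Suc n)
  then show ?case
    using assms(2) by (auto simp: nderiv_Suc vector_derivative_at)
qed (use assms in simp)

lemma smoothI:
  assumes "F 0 = f" "\<And>n x. (F n has_vector_derivative F (Suc n) x) (at x)"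
  shows "smooth f"
  unfolding smooth_def using nderiv_eqI[of F f] assms
  by (metis differentiableI_vector)

lemma
  assumes "smooth f"
  shows nderiv_mult_left: "nderiv n (\<lambda>x. c * f x) = (\<lambda>x. c * nderiv n f x)"
    and smooth_mult_left: "smooth (\<lambda>x. c * f x)"
proof -
  have *: "((\<lambda>x. c * nderiv n f x) has_vector_derivative c * nderiv (Suc n) f x) (at x)" for n x
    by (intro has_vector_derivative_mult_right smooth_has_vector_derivative assms)
  show "nderiv n (\<lambda>x. c * f x) = (\<lambda>x. c * nderiv n f x)"
    by (rule nderiv_eqI[where F = "\<lambda>n x. c * nderiv n f x"]) (simp, rule *)
  show "smooth (\<lambda>x. c * f x)"
    by (rule smoothI[where F = "\<lambda>n x. c * nderiv n f x"]) (simp, rule *)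
qed

lemma
  assumes "smooth f" "smooth g"
  shows nderiv_diff: "nderiv n (\<lambda>x. f x - g x) = (\<lambda>x. nderiv n f x - nderiv n g x)"
    and smooth_diff: "smooth (\<lambda>x. f x - g x)"
proof -
  have *: "((\<lambda>x. nderiv n f x - nderiv n g x) has_vector_derivative
      nderiv (Suc n) f x - nderiv (Suc n) g x) (at x)" for n x
    by (intro has_vector_derivative_diff smooth_has_vector_derivative assms)
  show "nderiv n (\<lambda>x. f x - g x) = (\<lambda>x. nderiv n f x - nderiv n g x)"
    by (rule nderiv_eqI[where F = "\<lambda>n x. nderiv n f x - nderiv n g x"]) (simp, rule *)
  show "smooth (\<lambda>x. f x - g x)"
    by (rule smoothI[where F = "\<lambda>n x. nderiv n f x - nderiv n g x"]) (simp, rule *)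
qed

lemma
  assumes "smooth f"
  shows nderiv_scale: "nderiv n (\<lambda>x. f (b * x)) = (\<lambda>x. of_real (b ^ n) * nderiv n f (b * x))"
    and smooth_scale: "smooth (\<lambda>x. f (b * x))"
proof -
  have *: "((\<lambda>x. of_real (b ^ n) * nderiv n f (b * x)) has_vector_derivative
      of_real (b ^ Suc n) * nderiv (Suc n) f (b * x)) (at x)" for n x
  proof -
    have "((\<lambda>x. b * x) has_vector_derivative b) (at x)"
      by (auto intro!: derivative_eq_intros)
    from vector_diff_chain_at[OF this smooth_has_vector_derivative[OF assms, of n]]
    have "((\<lambda>x. nderiv n f (b * x)) has_vector_derivative b *\<^sub>R nderiv (Suc n) f (b * x)) (at x)"
      by (simp add: o_def)
    from has_vector_derivative_mult_right[OF this, of "of_real (b ^ n)"]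
    show ?thesis by (simp add: scaleR_conv_of_real mult_ac)
  qed
  show "nderiv n (\<lambda>x. f (b * x)) = (\<lambda>x. of_real (b ^ n) * nderiv n f (b * x))"
    by (rule nderiv_eqI[where F = "\<lambda>n x. of_real (b ^ n) * nderiv n f (b * x)"]) (simp, rule *)
  show "smooth (\<lambda>x. f (b * x))"
    by (rule smoothI[where F = "\<lambda>n x. of_real (b ^ n) * nderiv n f (b * x)"]) (simp, rule *)
qed

section \<open>Modulated and translated Gaussians\<close>

text \<open>The index n counts derivatives. The function f at index 0 satisfies f' = l f with l(x) =
  -2 (x - \<eta>) + i \<xi>. Since l' = -2 and l'' = 0, the Leibniz rule leaves only two terms:
  f^(n+2) = l f^(n+1) - 2 (n+1) f^(n).\<close>

fun gauss_wave :: "real \<Rightarrow> real \<Rightarrow> nat \<Rightarrow> real \<Rightarrow> complex" where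
  "gauss_wave \<xi> \<eta> 0 x = exp (Complex (- ((x - \<eta>)\<^sup>2)) (\<xi> * x))"
| "gauss_wave \<xi> \<eta> (Suc 0) x = Complex (- 2 * (x - \<eta>)) \<xi> * gauss_wave \<xi> \<eta> 0 x"
| "gauss_wave \<xi> \<eta> (Suc (Suc n)) x =
     Complex (- 2 * (x - \<eta>)) \<xi> * gauss_wave \<xi> \<eta> (Suc n) x - of_nat (2 * Suc n) * gauss_wave \<xi> \<eta> n x"

lemma gauss_wave_has_vector_derivative:
  "(gauss_wave \<xi> \<eta> n has_vector_derivative gauss_wave \<xi> \<eta> (Suc n) x) (at x)"
proof -
  have lin: "((\<lambda>x. Complex (- 2 * (x - \<eta>)) \<xi>) has_vector_derivative - 2) (at x)"
    by (auto simp: has_vector_derivative_complex_iff intro!: derivative_eq_intros)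
  have zero: "((\<lambda>x. gauss_wave \<xi> \<eta> 0 x) has_vector_derivative gauss_wave \<xi> \<eta> (Suc 0) x) (at x)"
  proof -
    have "((\<lambda>x. Complex (- ((x - \<eta>)\<^sup>2)) (\<xi> * x)) has_vector_derivative
        Complex (- 2 * (x - \<eta>)) \<xi>) (at x)"
      by (auto simp: has_vector_derivative_complex_iff intro!: derivative_eq_intros)
    from field_vector_diff_chain_at[OF this DERIV_exp]
    show ?thesis by (simp add: o_def)
  qed
  show ?thesis
  proof (induction n rule: induct_nat_012)
    case 0
    from zero show ?case .
  next
    case 1
    have "((\<lambda>x. gauss_wave \<xi> \<eta> (Suc 0) x) has_vector_derivative gauss_wave \<xi> \<eta> (Suc (Suc 0)) x) (at x)"
      by (simp only: gauss_wave.simps(2))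
        (rule has_vector_derivative_eq_rhs[OF has_vector_derivative_mult[OF lin zero]], simp)
    then show ?case .
  next
    case (ge2 n)
    \<comment> \<open>Differentiating the linear factor contributes a further -2, which raises the
      coefficient 2 (n+1) to 2 (n+2).\<close>
    have "((\<lambda>x. gauss_wave \<xi> \<eta> (Suc (Suc n)) x) has_vector_derivative
        gauss_wave \<xi> \<eta> (Suc (Suc (Suc n))) x) (at x)"
      by (simp only: gauss_wave.simps(3)[of _ _ n])
        (rule has_vector_derivative_eq_rhs[OF has_vector_derivative_diff[OF
            has_vector_derivative_mult[OF lin ge2(2)] has_vector_derivative_mult_right[OF ge2(1)]]],
         simp add: algebra_simps)
    then show ?case .
  qed
qed

lemma
  shows smooth_gauss_wave: "smooth (gauss_wave \<xi> \<eta> 0)"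
    and nderiv_gauss_wave: "nderiv n (gauss_wave \<xi> \<eta> 0) = gauss_wave \<xi> \<eta> n"
  by (rule smoothI nderiv_eqI, simp, rule gauss_wave_has_vector_derivative)+

section \<open>Weighted bounds for the Gaussians and their derivatives\<close>

lemma power_le_fact_exp:
  assumes "(y::real) \<ge> 0"
  shows "y ^ n \<le> fact n * exp y"
proof -
  have "(\<lambda>k. y ^ k / fact k) sums exp y"
    using exp_converges[of y] by (simp add: scaleR_conv_of_real divide_inverse mult.commute)
  then have "y ^ n / fact n \<le> exp y"
    using sum_le_suminf[of "\<lambda>k. y ^ k / fact k" "{n}"] assms by (auto simp: sums_iff)
  then show ?thesis by (simp add: divide_le_eq mult.commute)
qed

text \<open>The linear factor in the recursion is at most 2 (1 + |x|) + 2 r. Its first part is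
  traded for one more power of 1 + |x|, so n drops while q rises; r and the coefficient n + 1 are
  absorbed by raising the order of (N + r)^N.\<close>

lemma gauss_wave_bound_aux:
  assumes "\<xi> \<ge> 0" "\<eta> \<ge> 0" "\<xi> + \<eta> \<le> r" "r \<ge> 1"
  shows "(1 + \<bar>x\<bar>) ^ q * norm (gauss_wave \<xi> \<eta> n x)
    \<le> (1 + exp 1) * 8 ^ n * 2 ^ q * (real (n + q) + r) ^ (n + q)"
proof -
  define C :: real where "C = 1 + exp 1"
  define D where "D = (\<lambda>N::nat. (real N + r) ^ N)"
  define B where "B = (\<lambda>n q. (1 + \<bar>x\<bar>) ^ q * norm (gauss_wave \<xi> \<eta> n x))"
  have C: "C > 0" by (simp add: C_def add_pos_pos)
  have D0: "D N \<ge> 0" for N using assms by (simp add: D_def)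
  \<comment> \<open>Passing from N to N + 1 brings a full factor N + 1 + r, which pays for r and for
    n + 1 in the recursion.\<close>
  have D_mult: "c * D N \<le> D (Suc N)" if "0 \<le> c" "c \<le> real (Suc N) + r" for c N
    unfolding D_def power_Suc using assms that by (intro mult_mono power_mono) auto
  have rD: "r * D N \<le> D (Suc N)" for N by (rule D_mult) (use assms in auto)
  have D_mono: "D N \<le> D (Suc N)" for N using D_mult[of 1 N] assms by simp
  have lin: "norm (Complex (- 2 * (x - \<eta>)) \<xi>) \<le> 2 * (1 + \<bar>x\<bar>) + 2 * r"
    using cmod_le[of "Complex (- 2 * (x - \<eta>)) \<xi>"] assms by (simp add: abs_if split: if_splits)
  have zero: "B 0 q \<le> C * 8 ^ 0 * 2 ^ q * D (0 + q)" for q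
  proof -
    define y where "y = \<bar>x - \<eta>\<bar>"
    have y: "y \<ge> 0" "(x - \<eta>)\<^sup>2 = y\<^sup>2" by (auto simp: y_def)
    have e: "exp (- y\<^sup>2) \<le> 1" by simp
    \<comment> \<open>For q = 0 both sides are 1; for q \<ge> 1 the base q + r is at least 1 +
      r.\<close>
    have D1: "(1 + r) ^ q \<le> D q"
      unfolding D_def using assms by (cases "q = 0") (auto intro!: power_mono)
    have D2: "fact q \<le> D q"
    proof -
      have "fact q \<le> real q ^ q" using fact_le_power[of q, where 'a = real] by simp
      also have "\<dots> \<le> D q" unfolding D_def using assms by (intro power_mono) auto
      finally show ?thesis .
    qed
    \<comment> \<open>The exponential series gives y^q \<le> q! exp y, and y - y^2 \<le> 1 lets the
      Gaussian absorb exp y.\<close>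
    have y_exp: "y ^ q * exp (- y\<^sup>2) \<le> exp 1 * D q"
    proof -
      have "y ^ q * exp (- y\<^sup>2) \<le> fact q * exp y * exp (- y\<^sup>2)"
        using power_le_fact_exp[OF y(1)] by (intro mult_right_mono) auto
      also have "\<dots> = fact q * exp (y - y\<^sup>2)" by (simp add: exp_diff exp_minus divide_inverse)
      also have "\<dots> \<le> D q * exp 1"
      proof (intro mult_mono D2)
        have "0 \<le> (y - 1)\<^sup>2" by simp
        then show "exp (y - y\<^sup>2) \<le> exp 1" using y(1) by (simp add: power2_eq_square algebra_simps)
      qed (use D0 in auto)
      finally show ?thesis by (simp add: mult.commute)
    qed
    \<comment> \<open>The weight is split at the centre \<eta>: replacing the sum by twice the
      maximum produces the factor 2^q.\<close>
    have "1 + \<bar>x\<bar> \<le> (1 + r) + y"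
      using assms abs_triangle_ineq[of "x - \<eta>" \<eta>] by (simp add: y_def)
    also have "\<dots> \<le> 2 * max (1 + r) y" by (auto simp: max_def)
    finally have "1 + \<bar>x\<bar> \<le> 2 * max (1 + r) y" .
    then have "(1 + \<bar>x\<bar>) ^ q \<le> (2 * max (1 + r) y) ^ q" by (intro power_mono) auto
    also have "\<dots> \<le> 2 ^ q * ((1 + r) ^ q + y ^ q)"
      using assms y by (auto simp: power_mult_distrib max_def)
    finally have "B 0 q \<le> 2 ^ q * ((1 + r) ^ q + y ^ q) * exp (- y\<^sup>2)"
      by (simp add: B_def y norm_exp_eq_Re mult_right_mono)
    also have "\<dots> = 2 ^ q * ((1 + r) ^ q * exp (- y\<^sup>2) + y ^ q * exp (- y\<^sup>2))"
      by (simp add: algebra_simps)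
    also have "\<dots> \<le> 2 ^ q * (D q * 1 + exp 1 * D q)"
      using D0 by (intro mult_left_mono add_mono y_exp mult_mono[OF D1 e]) auto
    finally show ?thesis by (simp add: C_def algebra_simps)
  qed
  have "B n q \<le> C * 8 ^ n * 2 ^ q * D (n + q)"
  \<comment> \<open>The index q must stay general, because order n is reduced to lower orders with
    weight exponent q + 1 as well as q.\<close>
  proof (induction n arbitrary: q rule: induct_nat_012)
    case 0
    from zero show ?case .
  next
    case 1
    have "B (Suc 0) q \<le> (1 + \<bar>x\<bar>) ^ q * ((2 * (1 + \<bar>x\<bar>) + 2 * r) * norm (gauss_wave \<xi> \<eta> 0 x))"
      unfolding B_def gauss_wave.simps norm_mult by (intro mult_left_mono mult_right_mono lin) auto
    also have "\<dots> = 2 * B 0 (Suc q) + 2 * r * B 0 q" by (simp add: B_def algebra_simps)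
    also have "\<dots> \<le> 2 * (C * 8 ^ 0 * 2 ^ Suc q * D (0 + Suc q)) + 2 * r * (C * 8 ^ 0 * 2 ^ q * D (0 + q))"
      using assms by (intro add_mono mult_left_mono zero) auto
    also have "\<dots> = C * 2 ^ q * (4 * D (Suc q) + 2 * (r * D q))" by (simp add: algebra_simps)
    also have "\<dots> \<le> C * 2 ^ q * (8 * D (Suc q))"
      using C rD[of q] D0[of "Suc q"] by (intro mult_left_mono) auto
    finally show ?case by (simp add: mult_ac)
  next
    case (ge2 n)
    define N where "N = n + q"
    have "norm (gauss_wave \<xi> \<eta> (Suc (Suc n)) x) \<le>
        (2 * (1 + \<bar>x\<bar>) + 2 * r) * norm (gauss_wave \<xi> \<eta> (Suc n) x) + real (2 * Suc n) * norm (gauss_wave \<xi> \<eta> n x)"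
      unfolding gauss_wave.simps
      by (rule order_trans[OF norm_triangle_ineq4], unfold norm_mult norm_of_nat)
        (intro add_mono mult_right_mono lin order_refl norm_ge_zero)
    then have "B (Suc (Suc n)) q \<le> (1 + \<bar>x\<bar>) ^ q * ((2 * (1 + \<bar>x\<bar>) + 2 * r) *
        norm (gauss_wave \<xi> \<eta> (Suc n) x) + real (2 * Suc n) * norm (gauss_wave \<xi> \<eta> n x))"
      unfolding B_def by (intro mult_left_mono) auto
    also have "\<dots> = 2 * B (Suc n) (Suc q) + 2 * r * B (Suc n) q + real (2 * Suc n) * B n q"
      by (simp add: B_def algebra_simps)
    also have "\<dots> \<le> 2 * (C * 8 ^ Suc n * 2 ^ Suc q * D (Suc n + Suc q))
        + 2 * r * (C * 8 ^ Suc n * 2 ^ q * D (Suc n + q)) + real (2 * Suc n) * (C * 8 ^ n * 2 ^ q * D (n + q))"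
      using assms by (intro add_mono mult_left_mono ge2) auto
    also have "\<dots> = C * 8 ^ n * 2 ^ q *
        (32 * D (Suc (Suc N)) + 16 * (r * D (Suc N)) + 2 * (real (Suc n) * D N))"
      by (simp add: N_def algebra_simps)
    \<comment> \<open>The three terms add up to at most 32 + 16 + 2 = 50 copies of the last
      \<open>D\<close>; the base 8 leaves room for 64 in two steps.\<close>
    also have "\<dots> \<le> C * 8 ^ n * 2 ^ q * (64 * D (Suc (Suc N)))"
    proof (intro mult_left_mono)
      have "real (Suc n) * D N \<le> D (Suc N)"
        by (rule D_mult) (use assms in \<open>auto simp: N_def\<close>)
      then show "32 * D (Suc (Suc N)) + 16 * (r * D (Suc N)) + 2 * (real (Suc n) * D N) \<le> 64 * D (Suc (Suc N))"
        using rD[of "Suc N"] D_mono[of "Suc N"] D0[of "Suc (Suc N)"] by linarith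
    qed (use C in auto)
    finally show ?case by (simp add: N_def mult_ac)
  qed
  then show ?thesis by (simp add: B_def C_def D_def)
qed

lemma gauss_wave_bound:
  assumes "\<xi> \<ge> 0" "\<eta> \<ge> 0" "\<xi> + \<eta> \<ge> 1"
  shows "(1 + \<bar>x\<bar>) ^ q * norm (gauss_wave \<xi> \<eta> n x)
    \<le> (1 + exp 1) * (8 * (real (n + q) + (\<xi> + \<eta>))) ^ (n + q)"
proof -
  have "(1 + \<bar>x\<bar>) ^ q * norm (gauss_wave \<xi> \<eta> n x)
    \<le> (1 + exp 1) * 8 ^ n * 2 ^ q * (real (n + q) + (\<xi> + \<eta>)) ^ (n + q)"
    using assms by (intro gauss_wave_bound_aux) auto
  also have "\<dots> \<le> (1 + exp 1) * 8 ^ n * 8 ^ q * (real (n + q) + (\<xi> + \<eta>)) ^ (n + q)"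
    using assms by (intro mult_right_mono mult_left_mono power_mono) (auto intro: add_nonneg_nonneg)
  finally show ?thesis by (simp only: power_add power_mult_distrib mult_ac)
qed

lemma norm_gauss_wave_center: "norm (gauss_wave \<xi> \<eta> 0 \<eta>) = 1"
  by (simp add: norm_exp_eq_Re)

text \<open>At the origin the recursion for the derivatives involves no cancellation.\<close>

lemma norm_gauss_wave_origin:
  assumes "\<xi> \<ge> 0"
  shows "norm (gauss_wave \<xi> 0 n 0) \<ge> \<xi> ^ n"
proof -
  \<comment> \<open>At 0 the linear factor is i \<xi>, and -1 = i^2, so both terms of the recursion
    carry the phase i^(n+2) with nonnegative real coefficients.\<close>
  have "\<exists>c. gauss_wave \<xi> 0 n 0 = \<i> ^ n * of_real c \<and> c \<ge> \<xi> ^ n"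
  proof (induction n rule: induct_nat_012)
    case 0
    show ?case by (intro exI[of _ 1]) (simp flip: zero_complex.code)
  next
    case 1
    show ?case by (intro exI[of _ \<xi>]) (simp add: Complex_eq)
  next
    case (ge2 n)
    then obtain c d where c: "gauss_wave \<xi> 0 n 0 = \<i> ^ n * of_real c" "c \<ge> \<xi> ^ n"
      and d: "gauss_wave \<xi> 0 (Suc n) 0 = \<i> ^ Suc n * of_real d" "d \<ge> \<xi> ^ Suc n" by blast
    show ?case
    proof (intro exI[of _ "\<xi> * d + real (2 * Suc n) * c"] conjI)
      show "gauss_wave \<xi> 0 (Suc (Suc n)) 0 = \<i> ^ Suc (Suc n) * of_real (\<xi> * d + real (2 * Suc n) * c)"
        by (simp add: c d Complex_eq algebra_simps)
      have "\<xi> * \<xi> ^ Suc n \<le> \<xi> * d" using d assms by (intro mult_left_mono)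
      moreover have "0 \<le> c" using c assms by (meson order_trans zero_le_power)
      ultimately show "\<xi> ^ Suc (Suc n) \<le> \<xi> * d + real (2 * Suc n) * c"
        by (simp add: add_increasing2)
    qed
  qed
  then show ?thesis by (auto simp: norm_mult norm_power)
qed

declare gauss_wave.simps [simp del]

section \<open>Seminorm estimates\<close>

lemma S_omega_term_le_p_omega:
  assumes "f \<in> S_omega \<omega>" "l > 0"
  shows "S_omega_term \<omega> l f z \<le> p_omega \<omega> l f"
  unfolding p_omega_def using assms by (intro cSUP_upper) (auto simp: S_omega_def)

lemma p_omega_leI: "(\<And>z. S_omega_term \<omega> l f z \<le> C) \<Longrightarrow> p_omega \<omega> l f \<le> C"
  unfolding p_omega_def by (intro cSUP_least) auto

lemma S_omegaI:
  assumes "smooth f" "\<And>l. l > 0 \<Longrightarrow> \<exists>C. \<forall>z. S_omega_term \<omega> l f z \<le> C"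
  shows "f \<in> S_omega \<omega>"
  using assms unfolding S_omega_def bdd_above_def by blast

lemma S_omega_smooth: "f \<in> S_omega \<omega> \<Longrightarrow> smooth f"
  by (simp add: S_omega_def)

lemma
  assumes f: "f \<in> S_omega \<omega>"
  shows S_omega_mult_left: "(\<lambda>x. c * f x) \<in> S_omega \<omega>"
    and p_omega_mult_left_le: "l > 0 \<Longrightarrow> p_omega \<omega> l (\<lambda>x. c * f x) \<le> norm c * p_omega \<omega> l f"
proof -
  have eq: "S_omega_term \<omega> l (\<lambda>x. c * f x) z = norm c * S_omega_term \<omega> l f z" for l z
    by (cases z) (simp add: S_omega_term_def nderiv_mult_left[OF S_omega_smooth[OF f]] norm_mult mult_ac)
  have le: "S_omega_term \<omega> l (\<lambda>x. c * f x) z \<le> norm c * p_omega \<omega> l f" if "l > 0" for l z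
    unfolding eq using S_omega_term_le_p_omega[OF f that] by (intro mult_left_mono) auto
  then show "(\<lambda>x. c * f x) \<in> S_omega \<omega>"
    by (intro S_omegaI smooth_mult_left[OF S_omega_smooth[OF f]]) blast
  show "l > 0 \<Longrightarrow> p_omega \<omega> l (\<lambda>x. c * f x) \<le> norm c * p_omega \<omega> l f"
    using le by (intro p_omega_leI) auto
qed

lemma S_omega_diff:
  assumes f: "f \<in> S_omega \<omega>" and g: "g \<in> S_omega \<omega>"
  shows "(\<lambda>x. f x - g x) \<in> S_omega \<omega>"
proof (rule S_omegaI)
  fix l :: real assume l: "l > 0"
  have "S_omega_term \<omega> l (\<lambda>x. f x - g x) z \<le> S_omega_term \<omega> l f z + S_omega_term \<omega> l g z" for z
  proof (cases z)
    case (fields x n q)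
    have "S_omega_term \<omega> l (\<lambda>x. f x - g x) z \<le>
        (1 + \<bar>x\<bar>) ^ q * (norm (nderiv n f x) + norm (nderiv n g x)) * exp (- l * young_conj \<omega> (real (n + q) / l))"
      unfolding S_omega_term_def fields prod.case nderiv_diff[OF f[THEN S_omega_smooth] g[THEN S_omega_smooth]]
      by (intro mult_right_mono mult_left_mono norm_triangle_ineq4) auto
    then show ?thesis by (simp add: S_omega_term_def fields algebra_simps)
  qed
  then show "\<exists>C. \<forall>z. S_omega_term \<omega> l (\<lambda>x. f x - g x) z \<le> C"
    using S_omega_term_le_p_omega[OF f l] S_omega_term_le_p_omega[OF g l]
    by (intro exI[of _ "p_omega \<omega> l f + p_omega \<omega> l g"] allI) (meson add_mono order_trans)
qed (rule smooth_diff[OF S_omega_smooth[OF f] S_omega_smooth[OF g]])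

text \<open>The factor b^n has modulus 1 and |b x| = |x|, so a reflection merely permutes the terms
  of the supremum.\<close>

lemma
  assumes f: "f \<in> S_omega \<omega>" and b: "b = 1 \<or> b = -1"
  shows S_omega_reflect: "(\<lambda>x. f (b * x)) \<in> S_omega \<omega>"
    and p_omega_reflect: "l > 0 \<Longrightarrow> p_omega \<omega> l (\<lambda>x. f (b * x)) \<le> p_omega \<omega> l f"
proof -
  have "S_omega_term \<omega> l (\<lambda>x. f (b * x)) (x, n, q) = S_omega_term \<omega> l f (b * x, n, q)" for l x n q
    using b by (auto simp: S_omega_term_def nderiv_scale[OF S_omega_smooth[OF f]] norm_mult norm_power)
  then have le: "S_omega_term \<omega> l (\<lambda>x. f (b * x)) z \<le> p_omega \<omega> l f" if "l > 0" for l z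
    using S_omega_term_le_p_omega[OF f that] by (cases z) auto
  then show "(\<lambda>x. f (b * x)) \<in> S_omega \<omega>"
    by (intro S_omegaI smooth_scale[OF S_omega_smooth[OF f]]) blast
  show "l > 0 \<Longrightarrow> p_omega \<omega> l (\<lambda>x. f (b * x)) \<le> p_omega \<omega> l f"
    using le by (intro p_omega_leI) auto
qed

text \<open>Multiplying by the inverse of the weight at l = 1 shows that the single seminorm
  \<open>p_omega \<omega> 1\<close> dominates every Schwartz seminorm, with a constant depending
  only on n + q and \<omega>.\<close>

lemma S_omega_Schwartz_term_le:
  assumes "f \<in> S_omega \<omega>"
  shows "(1 + \<bar>x\<bar>) ^ q * norm (nderiv n f x) \<le> exp (young_conj \<omega> (real (n + q))) * p_omega \<omega> 1 f"
proof -
  have "(1 + \<bar>x\<bar>) ^ q * norm (nderiv n f x) =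
      exp (young_conj \<omega> (real (n + q))) * S_omega_term \<omega> 1 f (x, n, q)"
    by (simp add: S_omega_term_def exp_minus)
  also have "\<dots> \<le> exp (young_conj \<omega> (real (n + q))) * p_omega \<omega> 1 f"
    using assms by (intro mult_left_mono S_omega_term_le_p_omega) auto
  finally show ?thesis .
qed

lemma S_omega_subset_Schwartz: "S_omega \<omega> \<subseteq> Schwartz"
  unfolding Schwartz_def bdd_above_def using S_omega_smooth S_omega_Schwartz_term_le by blast

lemma p_Schwartz_le_p_omega:
  "f \<in> S_omega \<omega> \<Longrightarrow> p_Schwartz q n f \<le> exp (young_conj \<omega> (real (n + q))) * p_omega \<omega> 1 f"
  unfolding p_Schwartz_def by (intro cSUP_least S_omega_Schwartz_term_le) auto

section \<open>Growth of weights and the Young conjugate\<close>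

context
  fixes \<omega> :: "real \<Rightarrow> real"
  assumes weight: "weight_function \<omega>"
begin

lemma weight_nonneg: "t \<ge> 0 \<Longrightarrow> \<omega> t \<ge> 0"
  using weight by (simp add: weight_function_def)

lemma weight_mono: "0 \<le> s \<Longrightarrow> s \<le> t \<Longrightarrow> \<omega> s \<le> \<omega> t"
  using weight by (auto simp: weight_function_def mono_on_def)

lemma eventually_ln_le_weight:
  assumes "c > 0"
  shows "eventually (\<lambda>t. ln (1 + t\<^sup>2) \<le> c * \<omega> t) at_top"
proof -
  have "(\<lambda>t. ln (1 + t\<^sup>2)) \<in> o[at_top](\<omega>)"
    using weight by (simp add: weight_function_def)
  from landau_o.smallD[OF this assms] show ?thesis
    using eventually_ge_at_top[of 0]
  proof eventually_elim
    case (elim t)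
    then show ?case using weight_nonneg[of t] by simp
  qed
qed

text \<open>By monotonicity the integral of \<omega>(s) / (1 + s^2) over (t, 2t] is at least t
  \<omega>(t) / (1 + 4 t^2). By (\<beta>) this is bounded by the tail of a convergent integral,
  which tends to 0, so \<omega>(t) = o(t).\<close>

lemma weight_sublinear:
  assumes "\<epsilon> > 0"
  obtains C where "\<And>t. t \<ge> 0 \<Longrightarrow> \<omega> t \<le> \<epsilon> * t + C"
proof -
  define g where "g = (\<lambda>t. indicator {0..} t * (\<omega> t / (1 + t\<^sup>2)))"
  have g: "integrable lborel g"
    using weight by (simp add: weight_function_def set_integrable_def g_def)
  have lim: "((\<lambda>y. \<integral>x. indicator {..y} x * g x \<partial>lborel) \<longlongrightarrow> (\<integral>x. g x \<partial>lborel)) at_top"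
    using tendsto_integral_at_top[OF _ g] by simp
  have tail: "\<omega> t * t / (1 + 4 * t\<^sup>2)
      \<le> (\<integral>x. g x \<partial>lborel) - (\<integral>x. indicator {..t} x * g x \<partial>lborel)" if "t \<ge> 0" for t
  proof -
    have i: "integrable lborel (\<lambda>x. indicator {..t} x * g x)"
      using integrable_mult_indicator[OF _ g, of "{..t}"] by simp
    have "\<omega> t * t / (1 + 4 * t\<^sup>2) = (\<integral>x. indicator {t<..2*t} x * (\<omega> t / (1 + 4 * t\<^sup>2)) \<partial>lborel)"
      using that by simp
    also have "\<dots> \<le> (\<integral>x. g x - indicator {..t} x * g x \<partial>lborel)"
    proof (rule integral_mono)
      show "integrable lborel (\<lambda>x. indicator {t<..2*t} x * (\<omega> t / (1 + 4 * t\<^sup>2)))"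
        using that by (intro integrable_mult_left integrable_real_indicator) auto
      show "integrable lborel (\<lambda>x. g x - indicator {..t} x * g x)"
        using g i by simp
      fix x
      have "\<omega> t / (1 + 4 * t\<^sup>2) \<le> \<omega> x / (1 + x\<^sup>2)" if "t < x" "x \<le> 2 * t"
      proof (rule frac_le)
        show "\<omega> t \<le> \<omega> x" using \<open>t \<ge> 0\<close> that by (intro weight_mono) auto
        show "1 + x\<^sup>2 \<le> 1 + 4 * t\<^sup>2"
          using power_mono[of x "2*t" 2] \<open>t \<ge> 0\<close> that by (simp add: power_mult_distrib)
        show "0 \<le> \<omega> x" using \<open>t \<ge> 0\<close> that by (intro weight_nonneg) auto
        show "0 < 1 + x\<^sup>2" by (intro add_pos_nonneg) auto
      qed
      moreover have "g x \<ge> 0"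
        using weight_nonneg[of x] by (auto simp: g_def indicator_def)
      ultimately show "indicator {t<..2*t} x * (\<omega> t / (1 + 4 * t\<^sup>2)) \<le> g x - indicator {..t} x * g x"
        using \<open>t \<ge> 0\<close> by (auto simp: indicator_def g_def)
    qed
    also have "\<dots> = (\<integral>x. g x \<partial>lborel) - (\<integral>x. indicator {..t} x * g x \<partial>lborel)"
      using g i by simp
    finally show ?thesis .
  qed
  \<comment> \<open>The threshold \<epsilon>/5 matches 1 + 4 t^2 \<le> 5 t^2, valid for t \<ge>
    1.\<close>
  have "eventually (\<lambda>y. (\<integral>x. indicator {..y} x * g x \<partial>lborel) > (\<integral>x. g x \<partial>lborel) - \<epsilon> / 5) at_top"
    using lim assms by (intro order_tendstoD(1)) auto
  from eventually_conj[OF this eventually_ge_at_top[of 1]]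
  obtain T where T: "\<And>t. t \<ge> T \<Longrightarrow>
      (\<integral>x. indicator {..t} x * g x \<partial>lborel) > (\<integral>x. g x \<partial>lborel) - \<epsilon> / 5 \<and> t \<ge> 1"
    unfolding eventually_at_top_linorder by blast
  have big: "\<omega> t \<le> \<epsilon> * t" if "t \<ge> T" for t
  proof -
    have t: "t \<ge> 1" using T[OF that] by simp
    have "\<omega> t * t / (1 + 4 * t\<^sup>2) \<le> \<epsilon> / 5"
      using tail[of t] T[OF that] by linarith
    then have "\<omega> t * t \<le> \<epsilon> / 5 * (1 + 4 * t\<^sup>2)"
      by (simp add: divide_le_eq add_pos_nonneg)
    also have "\<dots> \<le> \<epsilon> / 5 * (5 * t\<^sup>2)"
      using assms t one_le_power[of t 2] by (intro mult_left_mono) auto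
    also have "\<dots> = (\<epsilon> * t) * t" by (simp add: power2_eq_square)
    finally show ?thesis using t by simp
  qed
  show ?thesis
  proof (rule that[of "\<omega> (max T 0)"])
    fix t :: real assume t: "t \<ge> 0"
    show "\<omega> t \<le> \<epsilon> * t + \<omega> (max T 0)"
    proof (cases "t \<ge> T")
      case True
      then show ?thesis using big[OF True] weight_nonneg[of "max T 0"] by simp
    next
      case False
      then have "\<omega> t \<le> \<omega> (max T 0)" using t by (intro weight_mono) auto
      moreover have "0 \<le> \<epsilon> * t" using assms t by simp
      ultimately show ?thesis by linarith
    qed
  qed
qed

text \<open>Iterating (\<alpha>) handles the factors 2^k, the additive constants being absorbed into
  \<omega>(t) + 1. Monotonicity then reaches any R below some 2^k.\<close>

lemma weight_dilation:
  assumes "R \<ge> 0"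
  obtains L where "L \<ge> 0" "\<And>t. t \<ge> 0 \<Longrightarrow> \<omega> (R * t) \<le> L * (\<omega> t + 1)"
proof -
  obtain L where L: "L \<ge> 1" "\<And>t. t \<ge> 0 \<Longrightarrow> \<omega> (2 * t) \<le> L * (\<omega> t + 1)"
    using weight by (auto simp: weight_function_def)
  have pow: "\<exists>K\<ge>0. \<forall>t\<ge>0. \<omega> (2 ^ k * t) \<le> K * (\<omega> t + 1)" for k :: nat
  proof (induction k)
    case 0
    show ?case by (intro exI[of _ 1]) auto
  next
    case (Suc k)
    then obtain K where K: "K \<ge> 0" "\<And>t. t \<ge> 0 \<Longrightarrow> \<omega> (2 ^ k * t) \<le> K * (\<omega> t + 1)" by blast
    show ?case
    proof (intro exI[of _ "L * (K + 1)"] conjI allI impI)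
      fix t :: real assume t: "t \<ge> 0"
      have "\<omega> (2 ^ Suc k * t) \<le> L * (\<omega> (2 ^ k * t) + 1)"
        using L(2)[of "2 ^ k * t"] t by (simp add: mult_ac)
      also have "\<dots> \<le> L * (K * (\<omega> t + 1) + (\<omega> t + 1))"
        using L(1) K(2)[OF t] weight_nonneg[OF t] by (intro mult_left_mono add_mono) auto
      finally show "\<omega> (2 ^ Suc k * t) \<le> L * (K + 1) * (\<omega> t + 1)" by (simp add: algebra_simps)
    qed (use L K in simp)
  qed
  obtain k :: nat where k: "\<bar>R\<bar> < 2 ^ k"
    using real_arch_pow[of 2 "\<bar>R\<bar>"] by auto
  obtain K where K: "K \<ge> 0" "\<And>t. t \<ge> 0 \<Longrightarrow> \<omega> (2 ^ k * t) \<le> K * (\<omega> t + 1)"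
    using pow[of k] by blast
  show ?thesis
  proof (rule that[OF K(1)])
    fix t :: real assume t: "t \<ge> 0"
    have "\<omega> (R * t) \<le> \<omega> (2 ^ k * t)"
      using assms t k by (intro weight_mono mult_right_mono) auto
    with K(2)[OF t] show "\<omega> (R * t) \<le> K * (\<omega> t + 1)" by linarith
  qed
qed

section \<open>The Young conjugate: finiteness and lower bounds\<close>

lemma bdd_above_young_conj: "bdd_above ((\<lambda>t. s * t - \<omega> (exp t)) ` {0..})"
proof -
  \<comment> \<open>With this c, the consequence 2 t \<le> c \<omega>(exp t) of (\<gamma>) reads
    (|s| + 1) t \<le> \<omega>(exp t). Hence only a bounded range of t can make s t - \<omega>(exp
    t) positive.\<close>
  define c where "c = 2 / (\<bar>s\<bar> + 1)"
  have c: "c > 0" by (simp add: c_def add_pos_pos add_nonneg_pos)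
  obtain T where T: "\<And>t. t \<ge> T \<Longrightarrow> ln (1 + t\<^sup>2) \<le> c * \<omega> t"
    using eventually_ln_le_weight[OF c] unfolding eventually_at_top_linorder by blast
  define S where "S = ln (max T 1)"
  have S: "S \<ge> 0" by (simp add: S_def)
  show ?thesis
  proof (rule bdd_aboveI2)
    fix t :: real assume "t \<in> {0..}"
    then have t: "t \<ge> 0" by simp
    show "s * t - \<omega> (exp t) \<le> \<bar>s\<bar> * S"
    proof (cases "t \<ge> S")
      case True
      then have "exp S \<le> exp t" by simp
      then have "exp t \<ge> T" by (simp add: S_def)
      from T[OF this] have 1: "ln (1 + (exp t)\<^sup>2) \<le> c * \<omega> (exp t)" .
      have "2 * t = ln ((exp t)\<^sup>2)" by (simp add: ln_realpow)
      also have "\<dots> \<le> ln (1 + (exp t)\<^sup>2)" by (subst ln_le_cancel_iff) (auto intro: add_pos_pos)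
      also note 1
      finally have "2 * t \<le> c * \<omega> (exp t)" .
      then have "(\<bar>s\<bar> + 1) * t \<le> \<omega> (exp t)"
        by (simp add: c_def field_simps add_nonneg_pos split: if_splits)
      moreover have "s * t \<le> (\<bar>s\<bar> + 1) * t" using t by (intro mult_right_mono) auto
      moreover have "0 \<le> \<bar>s\<bar> * S" using S by simp
      ultimately show ?thesis by linarith
    next
      case False
      have "s * t \<le> \<bar>s\<bar> * S" using t False by (intro mult_mono) auto
      then show ?thesis using weight_nonneg[of "exp t"] by simp
    qed
  qed
qed

lemma young_conj_ge: "t \<ge> 0 \<Longrightarrow> s * t - \<omega> (exp t) \<le> young_conj \<omega> s"
  unfolding young_conj_def by (rule cSUP_upper[OF _ bdd_above_young_conj]) simp

lemma young_conj_mono: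
  assumes "s \<le> s'"
  shows "young_conj \<omega> s \<le> young_conj \<omega> s'"
  unfolding young_conj_def
proof (rule cSUP_mono[OF _ bdd_above_young_conj])
  show "\<exists>t'\<in>{0..}. s * t - \<omega> (exp t) \<le> s' * t' - \<omega> (exp t')" if "t \<in> {0..}" for t
    using that assms by (intro bexI[of _ t]) (auto intro: mult_right_mono)
qed simp

text \<open>The slope of a supporting line of \<open>\<omega> \<circ> exp\<close> at \<open>t\<close> realises the biconjugate.\<close>

lemma young_conj_le_support:
  obtains s where "s \<ge> 0" "young_conj \<omega> s \<le> s * t - \<omega> (exp t)"
proof -
  \<comment> \<open>This is the right-hand slope of \<omega> \<circ> exp at t, an infimum of
    difference quotients by convexity.\<close>
  define S where "S = Inf ((\<lambda>u. (\<omega> (exp t) - \<omega> (exp u)) / (t - u)) ` ({t<..} \<inter> UNIV))"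
  have conv: "convex_on UNIV (\<lambda>t. \<omega> (exp t))"
    using weight by (simp add: weight_function_def)
  have sup: "\<omega> (exp y) \<ge> \<omega> (exp t) + S * (y - t)" for y
    using convex_le_Inf_differential[OF conv, of t y] by (simp add: S_def)
  show ?thesis
  proof
    \<comment> \<open>A supporting line of an increasing function cannot fall: comparing with the
      point t - 1 gives S \<ge> 0.\<close>
    have "\<omega> (exp (t - 1)) \<le> \<omega> (exp t)" by (intro weight_mono) auto
    with sup[of "t - 1"] show "S \<ge> 0" by simp
    show "young_conj \<omega> S \<le> S * t - \<omega> (exp t)"
      unfolding young_conj_def
    proof (rule cSUP_least)
      fix y :: real assume "y \<in> {0..}"
      show "S * y - \<omega> (exp y) \<le> S * t - \<omega> (exp t)"
        using sup[of y] by (simp add: algebra_simps)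
    qed simp
  qed
qed

text \<open>For the supporting slope s at ln R, R^s exp(-young conjugate of s) is at least
  exp(\<omega>(R)). Derivative orders and weight exponents are integers, so s is rounded down, which
  costs at most one factor R.\<close>

lemma ex_power_young_conj_ge:
  assumes "R \<ge> 1"
  shows "\<exists>n. exp (\<omega> R) / R \<le> R ^ n * exp (- young_conj \<omega> (real n))"
proof -
  obtain s where s: "s \<ge> 0" "young_conj \<omega> s \<le> s * ln R - \<omega> R"
    using young_conj_le_support[of "ln R"] assms by auto
  define n where "n = nat \<lfloor>s\<rfloor>"
  have n: "real n \<le> s" "s \<le> real n + 1" using s(1) by (auto simp: n_def)
  have "young_conj \<omega> (real n) \<le> s * ln R - \<omega> R"
    using young_conj_mono[OF n(1)] s(2) by linarith
  also have "\<dots> \<le> (real n + 1) * ln R - \<omega> R"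
    using n(2) assms by (intro diff_right_mono mult_right_mono) auto
  finally have "\<omega> R - ln R \<le> real n * ln R + - young_conj \<omega> (real n)"
    by (simp add: algebra_simps)
  then have "exp (\<omega> R - ln R) \<le> exp (real n * ln R + - young_conj \<omega> (real n))" by simp
  also have "\<dots> = R ^ n * exp (- young_conj \<omega> (real n))"
    using assms by (simp only: exp_add) (simp add: exp_of_nat_mult)
  finally show ?thesis using assms by (auto simp: exp_diff)
qed

text \<open>Test the Young conjugate at \<open>t = ln (8 e (N + r))\<close>: one factor \<open>e\<close> is spent on absorbing
  the part of \<open>\<omega>\<close> that is linear in \<open>N\<close>.\<close>

lemma power_le_young_conj:
  assumes "\<mu> > 0"
  obtains C \<kappa> where "C > 0" "\<kappa> \<ge> 0"
    "\<And>N r. r \<ge> 1 \<Longrightarrow>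
      (8 * (real N + r)) ^ N \<le> C * exp (\<kappa> * \<omega> r) * exp (\<mu> * young_conj \<omega> (real N / \<mu>))"
proof -
  define R :: real where "R = 8 * exp 1"
  have R: "R \<ge> 1" using exp_ge_add_one_self[of 1] unfolding R_def by linarith
  \<comment> \<open>The slope is chosen so that \<mu> \<omega>(2 R N) \<le> N + \<mu> C: coefficient
    exactly 1 in front of N.\<close>
  obtain C where C: "\<And>t. t \<ge> 0 \<Longrightarrow> \<omega> t \<le> (1 / (2 * R * \<mu>)) * t + C"
    using weight_sublinear[of "1 / (2 * R * \<mu>)"] R assms by auto
  obtain L where L: "L \<ge> 0" "\<And>t. t \<ge> 0 \<Longrightarrow> \<omega> (2 * R * t) \<le> L * (\<omega> t + 1)"
    using weight_dilation[of "2 * R"] R by auto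
  show ?thesis
  proof
    fix N r assume r: "(r::real) \<ge> 1"
    define M where "M = real N + r"
    have M: "M \<ge> 1" using r by (simp add: M_def)
    have RM: "R * M \<ge> 1" using mult_mono[of 1 R 1 M] R M by simp
    \<comment> \<open>As N + r \<le> 2 max(N, r), the weight at R M separates into one term in N and
      one in r; the first is treated by sublinearity, the second by (\<alpha>).\<close>
    have "\<omega> (R * M) \<le> \<omega> (2 * R * real N) + \<omega> (2 * R * r)"
    proof (cases "real N \<le> r")
      case True
      then have "R * M \<le> 2 * R * r" using R by (simp add: M_def mult.assoc)
      then show ?thesis
        using weight_mono[of "R * M" "2 * R * r"] RM weight_nonneg[of "2 * R * real N"] R by simp
    next
      case False
      then have "R * M \<le> 2 * R * real N" using R by (simp add: M_def mult.assoc)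
      then show ?thesis
        using weight_mono[of "R * M" "2 * R * real N"] RM weight_nonneg[of "2 * R * r"] R r by simp
    qed
    also have "\<dots> \<le> (real N / \<mu> + C) + L * (\<omega> r + 1)"
      using C[of "2 * R * real N"] L(2)[of r] R r by (intro add_mono) auto
    finally have "\<mu> * \<omega> (R * M) \<le> \<mu> * ((real N / \<mu> + C) + L * (\<omega> r + 1))"
      using assms by (intro mult_left_mono) auto
    also have "\<dots> = real N + \<mu> * C + \<mu> * L * \<omega> r + \<mu> * L"
      using assms by (simp add: field_simps)
    finally have w: "\<mu> * \<omega> (R * M) \<le> real N + \<mu> * C + \<mu> * L * \<omega> r + \<mu> * L" .
    have "\<mu> * (real N / \<mu> * ln (R * M) - \<omega> (exp (ln (R * M)))) \<le> \<mu> * young_conj \<omega> (real N / \<mu>)"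
      using assms RM by (intro mult_left_mono young_conj_ge) auto
    then have y: "real N * ln (R * M) - \<mu> * \<omega> (R * M) \<le> \<mu> * young_conj \<omega> (real N / \<mu>)"
      using assms RM by (simp add: right_diff_distrib)
    have "ln (R * M) = ln (8 * M) + 1"
      using M by (simp add: R_def ln_mult)
    with y w have "real N * ln (8 * M) \<le>
        (\<mu> * C + \<mu> * L) + (\<mu> * L) * \<omega> r + \<mu> * young_conj \<omega> (real N / \<mu>)"
      by (simp add: algebra_simps)
    then have "exp (real N * ln (8 * M)) \<le>
        exp ((\<mu> * C + \<mu> * L) + (\<mu> * L) * \<omega> r + \<mu> * young_conj \<omega> (real N / \<mu>))" by simp
    then show "(8 * (real N + r)) ^ N \<le>
        exp (\<mu> * C + \<mu> * L) * exp ((\<mu> * L) * \<omega> r) * exp (\<mu> * young_conj \<omega> (real N / \<mu>))"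
      using M by (simp only: exp_add) (simp add: exp_of_nat_mult M_def)
  qed (use assms L in auto)
qed

section \<open>Seminorms of the Gaussians, uniformly in frequency and centre\<close>

lemma S_omega_term_gauss_wave:
  assumes "\<mu> > 0"
  obtains C \<kappa> where "C > 0" "\<kappa> \<ge> 0"
    "\<And>\<xi> \<eta> z. \<xi> \<ge> 0 \<Longrightarrow> \<eta> \<ge> 0 \<Longrightarrow> \<xi> + \<eta> \<ge> 1 \<Longrightarrow>
      S_omega_term \<omega> \<mu> (gauss_wave \<xi> \<eta> 0) z \<le> C * exp (\<kappa> * \<omega> (\<xi> + \<eta>))"
proof -
  obtain C \<kappa> where C: "C > 0" "\<kappa> \<ge> 0"
    "\<And>N r. r \<ge> 1 \<Longrightarrow>
      (8 * (real N + r)) ^ N \<le> C * exp (\<kappa> * \<omega> r) * exp (\<mu> * young_conj \<omega> (real N / \<mu>))"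
    using power_le_young_conj[OF assms] by blast
  show ?thesis
  proof
    show "(1 + exp 1) * C > 0" using C by (intro mult_pos_pos add_pos_pos) auto
    fix \<xi> \<eta> :: real and z :: "real \<times> nat \<times> nat"
    assume r: "\<xi> \<ge> 0" "\<eta> \<ge> 0" "\<xi> + \<eta> \<ge> 1"
    obtain x n q where z: "z = (x, n, q)" by (cases z)
    define Y where "Y = \<mu> * young_conj \<omega> (real (n + q) / \<mu>)"
    have "S_omega_term \<omega> \<mu> (gauss_wave \<xi> \<eta> 0) z =
        (1 + \<bar>x\<bar>) ^ q * norm (gauss_wave \<xi> \<eta> n x) * exp (- Y)"
      by (simp add: S_omega_term_def z nderiv_gauss_wave Y_def)
    also have "\<dots> \<le> (1 + exp 1) * (8 * (real (n + q) + (\<xi> + \<eta>))) ^ (n + q) * exp (- Y)"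
      using r by (intro mult_right_mono gauss_wave_bound) auto
    \<comment> \<open>The order n + q enters only through exp Y, which the weight exp (-Y) cancels.
      What remains depends on \<xi> + \<eta> alone.\<close>
    also have "\<dots> \<le> (1 + exp 1) * (C * exp (\<kappa> * \<omega> (\<xi> + \<eta>)) * exp Y) * exp (- Y)"
      unfolding Y_def using r by (intro mult_right_mono mult_left_mono C) (auto intro: add_nonneg_nonneg)
    also have "\<dots> = (1 + exp 1) * C * exp (\<kappa> * \<omega> (\<xi> + \<eta>))"
      by (simp add: exp_minus)
    finally show "S_omega_term \<omega> \<mu> (gauss_wave \<xi> \<eta> 0) z \<le> (1 + exp 1) * C * exp (\<kappa> * \<omega> (\<xi> + \<eta>))" .
  qed (rule C)
qed

lemma gauss_wave_in_S_omega:
  assumes "\<xi> \<ge> 0" "\<eta> \<ge> 0" "\<xi> + \<eta> \<ge> 1"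
  shows "gauss_wave \<xi> \<eta> 0 \<in> S_omega \<omega>"
proof (rule S_omegaI[OF smooth_gauss_wave])
  fix l :: real assume "l > 0"
  then show "\<exists>C. \<forall>z. S_omega_term \<omega> l (gauss_wave \<xi> \<eta> 0) z \<le> C"
    using S_omega_term_gauss_wave assms by (metis (no_types))
qed

lemma p_omega_gauss_wave:
  assumes "\<mu> > 0"
  obtains C \<kappa> where "C > 0" "\<kappa> \<ge> 0"
    "\<And>\<xi> \<eta>. \<xi> \<ge> 0 \<Longrightarrow> \<eta> \<ge> 0 \<Longrightarrow> \<xi> + \<eta> \<ge> 1 \<Longrightarrow>
      p_omega \<omega> \<mu> (gauss_wave \<xi> \<eta> 0) \<le> C * exp (\<kappa> * \<omega> (\<xi> + \<eta>))"
proof -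
  obtain C \<kappa> where C: "C > 0" "\<kappa> \<ge> 0"
    "\<And>\<xi> \<eta> z. \<xi> \<ge> 0 \<Longrightarrow> \<eta> \<ge> 0 \<Longrightarrow> \<xi> + \<eta> \<ge> 1 \<Longrightarrow>
      S_omega_term \<omega> \<mu> (gauss_wave \<xi> \<eta> 0) z \<le> C * exp (\<kappa> * \<omega> (\<xi> + \<eta>))"
    using S_omega_term_gauss_wave[OF assms] by blast
  show ?thesis by (rule that[OF C(1,2)]) (intro p_omega_leI C(3))
qed

section \<open>Condition (\<zeta>) against dilations of the weight\<close>

lemma zeta_iterate:
  assumes "zeta_condition \<omega>"
  obtains H where "H \<ge> 1"
    "\<And>j::nat. \<exists>D. \<forall>t\<ge>0. 2 ^ j * \<omega> t \<le> \<omega> (H ^ j * t) + D"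
proof -
  obtain H where H: "H \<ge> 1" "\<And>t. t \<ge> 0 \<Longrightarrow> 2 * \<omega> t \<le> \<omega> (H * t) + H"
    using assms by (auto simp: zeta_condition_def)
  have "\<exists>D. \<forall>t\<ge>0. 2 ^ j * \<omega> t \<le> \<omega> (H ^ j * t) + D" for j :: nat
  proof (induction j)
    case 0
    show ?case by (intro exI[of _ 0]) auto
  next
    case (Suc j)
    then obtain D where D: "\<And>t. t \<ge> 0 \<Longrightarrow> 2 ^ j * \<omega> t \<le> \<omega> (H ^ j * t) + D" by blast
    show ?case
    proof (intro exI[of _ "H + 2 * D"] allI impI)
      fix t :: real assume t: "t \<ge> 0"
      show "2 ^ Suc j * \<omega> t \<le> \<omega> (H ^ Suc j * t) + (H + 2 * D)"
        using D[OF t] H(2)[of "H ^ j * t"] H(1) t by (simp add: mult.assoc)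
    qed
  qed
  with that[OF H(1)] show ?thesis by blast
qed

text \<open>If dilations by all powers of \<open>\<beta> > 1\<close> were controlled by a single exponential weight,
  iterating \<open>(\<zeta>)\<close> would force \<open>exp \<circ> \<omega>\<close> to grow at most linearly.\<close>

lemma weight_dilation_growth:
  assumes "zeta_condition \<omega>" "\<beta> > 1" "\<kappa> \<ge> 0"
    and growth: "\<And>k::nat. k \<ge> 1 \<Longrightarrow>
      \<exists>M. \<forall>r\<ge>1. exp (\<omega> (\<beta> ^ k * r)) / (\<beta> ^ k * r) \<le> M * exp (\<kappa> * \<omega> r)"
  shows False
proof -
  obtain H where H: "H \<ge> 1" "\<And>j::nat. \<exists>D. \<forall>t\<ge>0. 2 ^ j * \<omega> t \<le> \<omega> (H ^ j * t) + D"
    using zeta_iterate[OF assms(1)] by blast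
  \<comment> \<open>One unit more than \<kappa> is requested, so that after cancelling exp(\<kappa>
    \<omega>(r)) a full exp(\<omega>(r)) survives on the left.\<close>
  obtain j :: nat where j: "\<kappa> + 1 < 2 ^ j" using real_arch_pow[of 2 "\<kappa> + 1"] by auto
  obtain D where D: "\<And>t. t \<ge> 0 \<Longrightarrow> 2 ^ j * \<omega> t \<le> \<omega> (H ^ j * t) + D" using H(2) by blast
  obtain k0 :: nat where k0: "H ^ j < \<beta> ^ k0" using real_arch_pow[OF assms(2)] by blast
  \<comment> \<open>The successor guarantees k \<ge> 1, as the growth hypothesis demands.\<close>
  define k where "k = Suc k0"
  have "\<beta> ^ k0 \<le> \<beta> ^ k" using assms(2) by (intro power_increasing) (auto simp: k_def)
  with k0 have k: "H ^ j \<le> \<beta> ^ k" "k \<ge> 1" by (auto simp: k_def)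
  obtain M where M: "\<And>r. r \<ge> 1 \<Longrightarrow> exp (\<omega> (\<beta> ^ k * r)) / (\<beta> ^ k * r) \<le> M * exp (\<kappa> * \<omega> r)"
    using growth[OF k(2)] by blast
  have b: "\<beta> ^ k > 0" using assms(2) by simp
  define K where "K = exp D * (M * \<beta> ^ k)"
  have lin: "exp (\<omega> r) \<le> K * r" if r: "r \<ge> 1" for r
  proof -
    have "(\<kappa> + 1) * \<omega> r \<le> 2 ^ j * \<omega> r"
      using j weight_nonneg[of r] r by (intro mult_right_mono) auto
    also have "\<dots> \<le> \<omega> (H ^ j * r) + D" using D r by simp
    also have "\<dots> \<le> \<omega> (\<beta> ^ k * r) + D"
      using k(1) r H(1) by (intro add_right_mono weight_mono mult_right_mono) auto
    finally have "exp ((\<kappa> + 1) * \<omega> r) \<le> exp (\<omega> (\<beta> ^ k * r) + D)" by simp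
    also have "\<dots> = exp D * exp (\<omega> (\<beta> ^ k * r))" by (simp add: exp_add mult.commute)
    also have "\<dots> \<le> exp D * (M * exp (\<kappa> * \<omega> r) * (\<beta> ^ k * r))"
      using M[OF r] b r by (intro mult_left_mono) (auto simp: divide_le_eq)
    also have "\<dots> = (K * r) * exp (\<kappa> * \<omega> r)" by (simp add: K_def)
    finally have "exp (\<omega> r) * exp (\<kappa> * \<omega> r) \<le> (K * r) * exp (\<kappa> * \<omega> r)"
      by (simp add: distrib_right add.commute flip: exp_add)
    then show ?thesis by simp
  qed
  \<comment> \<open>By (\<gamma>), 1 + T^2 \<le> exp(\<omega>(T)) for large T, whereas the linear
    bound gives at most K T \<le> T^2 once T \<ge> K.\<close>
  have "eventually (\<lambda>t. ln (1 + t\<^sup>2) \<le> 1 * \<omega> t) at_top"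
    by (rule eventually_ln_le_weight) simp
  from eventually_conj[OF this eventually_ge_at_top[of "max 1 K"]]
  obtain T where T: "ln (1 + T\<^sup>2) \<le> \<omega> T" "T \<ge> 1" "T \<ge> K"
    unfolding eventually_at_top_linorder by auto
  have "1 + T\<^sup>2 > 0" by (intro add_pos_nonneg) auto
  then have "1 + T\<^sup>2 = exp (ln (1 + T\<^sup>2))" by simp
  also have "\<dots> \<le> exp (\<omega> T)" using T by simp
  also have "\<dots> \<le> K * T" by (rule lin) fact
  also have "\<dots> \<le> T\<^sup>2" using T by (simp add: power2_eq_square)
  finally show False by simp
qed

end

section \<open>Dilation operators\<close>

lemma funpow_scale: "(\<lambda>x. a * x) ^^ k = (\<lambda>x. a ^ k * (x::real))"
  by (induction k) (auto simp: fun_eq_iff)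

lemma comp_op_funpow: "comp_op \<psi> ^^ k = comp_op (\<psi> ^^ k)"
proof (induction k)
  case (Suc k)
  have "comp_op \<psi> ^^ Suc k = comp_op \<psi> \<circ> comp_op (\<psi> ^^ k)" by (simp add: Suc)
  also have "\<dots> = comp_op (\<psi> ^^ Suc k)" by (simp add: comp_op_def fun_eq_iff funpow_swap1)
  finally show ?case .
qed (simp add: comp_op_def fun_eq_iff)

lemma linear_into_comp_op: "linear_into E F (comp_op \<psi>) \<longleftrightarrow> comp_op \<psi> ` E \<subseteq> F"
  by (auto simp: linear_into_def comp_op_def)

lemma linear_into_funpow:
  assumes "linear_into E E T" "f \<in> E"
  shows "(T ^^ k) f \<in> E"
  using assms by (induction k) (auto simp: linear_into_def)

lemma m_topologizable_imp_topologizable: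
  assumes "m_topologizable E P U"
  shows "topologizable E P U"
  unfolding topologizable_def
proof (intro conjI ballI)
  fix p assume "p \<in> P"
  then obtain q C where "q \<in> P" "C \<ge> 1" "\<forall>k\<ge>1. \<forall>f\<in>E. p ((U ^^ k) f) \<le> C ^ k * q f"
    using assms unfolding m_topologizable_def by blast
  then show "\<exists>q\<in>P. \<forall>k\<ge>1. \<exists>M>0. \<forall>f\<in>E. p ((U ^^ k) f) \<le> M * q f"
    by (intro bexI[of _ q] allI impI exI[of _ "C ^ _"]) auto
qed (use assms in \<open>simp add: m_topologizable_def\<close>)

abbreviation dilation :: "real \<Rightarrow> (real \<Rightarrow> complex) \<Rightarrow> real \<Rightarrow> complex" where
  "dilation a \<equiv> comp_op (\<lambda>x. a * x)"

lemma dilation_funpow: "(dilation a ^^ k) f = (\<lambda>x. f (a ^ k * x))"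
  by (simp add: comp_op_funpow funpow_scale comp_op_def o_def)

text \<open>A small multiple of \<open>f\<close> lies in the neighbourhood of \<open>0\<close> supplied by equicontinuity.\<close>

lemma equicontinuous_Schwartz_bounded:
  assumes maps: "\<And>m. m \<ge> 1 \<Longrightarrow> (dilation a ^^ m) ` S_omega \<omega> \<subseteq> Schwartz"
    and equi: "equicontinuous (S_omega \<omega>) (S_omega_seminorms \<omega>) Schwartz_seminorms {dilation a ^^ m | m. m \<ge> 1}"
    and f: "f \<in> S_omega \<omega>"
  obtains B where "\<And>m x. m \<ge> 1 \<Longrightarrow> (1 + \<bar>x\<bar>) ^ q * norm (nderiv n (\<lambda>x. f (a ^ m * x)) x) \<le> B"
proof -
  have zero: "(\<lambda>x. 0) \<in> S_omega \<omega>"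
    using S_omega_mult_left[OF f, of 0] by simp
  have "p_Schwartz q n \<in> Schwartz_seminorms" by (auto simp: Schwartz_seminorms_def)
  from equi[unfolded equicontinuous_def, rule_format, OF zero this zero_less_one]
  obtain P0 d where P0: "P0 \<subseteq> S_omega_seminorms \<omega>" "finite P0" "d > 0"
    and near: "\<And>U g. U \<in> {dilation a ^^ m | m. m \<ge> 1} \<Longrightarrow> g \<in> S_omega \<omega> \<Longrightarrow> (\<forall>p\<in>P0. p (\<lambda>x. g x - 0) < d) \<Longrightarrow>
      p_Schwartz q n (\<lambda>x. U g x - U (\<lambda>x. 0) x) < 1"
    by blast
  have small: "p_Schwartz q n (\<lambda>x. g (a ^ m * x)) < 1"
    if "m \<ge> 1" "g \<in> S_omega \<omega>" "\<forall>p\<in>P0. p g < d" for m g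
    using near[of "dilation a ^^ m" g] that by (auto simp: dilation_funpow)
  \<comment> \<open>A dominates all the finitely many p f and is positive; with c = d / (2 A) each
    seminorm of c f is at most d/2.\<close>
  define A where "A = (\<Sum>p\<in>P0. \<bar>p f\<bar>) + 1"
  have A: "A > 0" by (simp add: A_def add_nonneg_pos sum_nonneg)
  define c where "c = d / (2 * A)"
  have c: "c > 0" using A P0 by (simp add: c_def)
  have "p (\<lambda>x. of_real c * f x) < d" if p: "p \<in> P0" for p
  proof -
    obtain l where l: "p = p_omega \<omega> l" "l > 0" using p P0(1) by (auto simp: S_omega_seminorms_def)
    have "p (\<lambda>x. of_real c * f x) \<le> c * p f"
      using p_omega_mult_left_le[OF f l(2), of "of_real c"] c by (simp add: l)
    also have "\<dots> \<le> c * A"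
    proof (intro mult_left_mono)
      have "\<bar>p f\<bar> \<le> (\<Sum>p\<in>P0. \<bar>p f\<bar>)" using P0 p by (intro member_le_sum) auto
      then show "p f \<le> A" by (simp add: A_def)
    qed (use c in simp)
    also have "\<dots> < d" using A P0 by (simp add: c_def)
    finally show ?thesis .
  qed
  then have small': "p_Schwartz q n (\<lambda>x. of_real c * f (a ^ m * x)) < 1" if "m \<ge> 1" for m
    using small[OF that S_omega_mult_left[OF f], of "of_real c"] by auto
  show ?thesis
  proof
    fix m :: nat and x :: real assume m: "m \<ge> 1"
    \<comment> \<open>Only membership in the Schwartz space makes the real supremum
      \<open>p_Schwartz\<close> an upper bound for its terms.\<close>
    have "(\<lambda>x. of_real c * f (a ^ m * x)) \<in> Schwartz"
      using maps[OF m] S_omega_mult_left[OF f, of "of_real c"] by (force simp: dilation_funpow)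
    then have "(1 + \<bar>x\<bar>) ^ q * norm (nderiv n (\<lambda>x. of_real c * f (a ^ m * x)) x)
        \<le> p_Schwartz q n (\<lambda>x. of_real c * f (a ^ m * x))"
      unfolding p_Schwartz_def by (intro cSUP_upper) (auto simp: Schwartz_def)
    with small'[OF m] have "(1 + \<bar>x\<bar>) ^ q * norm (nderiv n (\<lambda>x. of_real c * f (a ^ m * x)) x) \<le> 1"
      by linarith
    then have "c * ((1 + \<bar>x\<bar>) ^ q * norm (nderiv n (\<lambda>x. f (a ^ m * x)) x)) \<le> 1"
      using c by (simp add: nderiv_mult_left[OF smooth_scale[OF S_omega_smooth[OF f]]] norm_mult mult.left_commute)
    then show "(1 + \<bar>x\<bar>) ^ q * norm (nderiv n (\<lambda>x. f (a ^ m * x)) x) \<le> 1 / c"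
      using c by (simp add: pos_le_divide_eq mult.commute)
  qed
qed

section \<open>The case a = 1 or a = -1\<close>

lemma power_unit: "a = 1 \<or> a = -1 \<Longrightarrow> a ^ k = 1 \<or> a ^ k = (-1 :: real)"
  by (cases "even k") (auto simp: minus_one_power_iff)

lemma
  assumes a1: "a = 1 \<or> a = (-1 :: real)"
  shows funpow_unit_in_S_omega: "f \<in> S_omega \<omega> \<Longrightarrow> (dilation a ^^ k) f \<in> S_omega \<omega>"
    and p_omega_funpow_unit: "f \<in> S_omega \<omega> \<Longrightarrow> p \<in> S_omega_seminorms \<omega> \<Longrightarrow> p ((dilation a ^^ k) f) \<le> p f"
  using S_omega_reflect[OF _ power_unit[OF a1, of k]] p_omega_reflect[OF _ power_unit[OF a1, of k]]
  by (auto simp: dilation_funpow S_omega_seminorms_def)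

text \<open>Linearity and p(T^k(g - f)) \<le> p(g - f) allow the neighbourhood to be given by p and
  e themselves. The predicate \<open>P\<close> covers both the single operator and the family of all
  iterates.\<close>

lemma unit_imp_equicontinuous:
  assumes a1: "a = 1 \<or> a = -1"
  shows "equicontinuous (S_omega \<omega>) (S_omega_seminorms \<omega>) (S_omega_seminorms \<omega>) {dilation a ^^ k | k. P k}"
  unfolding equicontinuous_def
proof (intro ballI allI impI)
  fix f p and e :: real
  assume f: "f \<in> S_omega \<omega>" and p: "p \<in> S_omega_seminorms \<omega>" and e: "e > 0"
  have "p (\<lambda>x. (dilation a ^^ k) g x - (dilation a ^^ k) f x) < e"
    if g: "g \<in> S_omega \<omega>" "p (\<lambda>x. g x - f x) < e" for k g
    using p_omega_funpow_unit[OF a1 S_omega_diff[OF g(1) f] p, where k = k] g(2)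
    by (simp add: dilation_funpow)
  then show "\<exists>P0\<subseteq>S_omega_seminorms \<omega>. finite P0 \<and> (\<exists>d>0. \<forall>U\<in>{dilation a ^^ k | k. P k}. \<forall>g\<in>S_omega \<omega>.
      (\<forall>p\<in>P0. p (\<lambda>x. g x - f x) < d) \<longrightarrow> p (\<lambda>x. U g x - U f x) < e)"
    using p e by (intro exI[of _ "{p}"] conjI exI[of _ e]) auto
qed

lemma unit_imp_continuous:
  assumes a1: "a = 1 \<or> a = -1"
  shows "continuous_linear_operator (S_omega \<omega>) (S_omega_seminorms \<omega>) (dilation a)"
  using funpow_unit_in_S_omega[OF a1, where k = 1] unit_imp_equicontinuous[OF a1, where P = "\<lambda>k. k = 1"]
  by (auto simp: continuous_linear_operator_def linear_into_comp_op)

lemma unit_imp_power_bounded: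
  assumes "a = 1 \<or> a = -1"
  shows "power_bounded (S_omega \<omega>) (S_omega_seminorms \<omega>) (dilation a)"
  using unit_imp_equicontinuous[OF assms] unit_imp_continuous[OF assms] by (simp add: power_bounded_def)

lemma unit_imp_m_topologizable:
  assumes "a = 1 \<or> a = -1"
  shows "m_topologizable (S_omega \<omega>) (S_omega_seminorms \<omega>) (dilation a)"
  unfolding m_topologizable_def
proof (intro conjI ballI)
  fix p assume p: "p \<in> S_omega_seminorms \<omega>"
  show "\<exists>q\<in>S_omega_seminorms \<omega>. \<exists>C\<ge>1. \<forall>k\<ge>1. \<forall>f\<in>S_omega \<omega>. p ((dilation a ^^ k) f) \<le> C ^ k * q f"
    using p_omega_funpow_unit[OF assms _ p] p by (intro bexI[of _ p] exI[of _ 1]) auto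
qed (rule unit_imp_continuous[OF assms])

text \<open>Each Schwartz seminorm is at most K times \<open>p_omega \<omega> 1\<close>, so
  equicontinuity into \<open>S_omega\<close> is applied to that one seminorm with tolerance e /
  K.\<close>

lemma power_bounded_imp_equicontinuous_Schwartz:
  assumes "power_bounded (S_omega \<omega>) (S_omega_seminorms \<omega>) (dilation a)"
  shows "(dilation a ^^ m) ` S_omega \<omega> \<subseteq> Schwartz"
    and "equicontinuous (S_omega \<omega>) (S_omega_seminorms \<omega>) Schwartz_seminorms {dilation a ^^ m | m. m \<ge> 1}"
proof -
  have lin: "linear_into (S_omega \<omega>) (S_omega \<omega>) (dilation a)"
    and equi: "equicontinuous (S_omega \<omega>) (S_omega_seminorms \<omega>) (S_omega_seminorms \<omega>) {dilation a ^^ m | m. m \<ge> 1}"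
    using assms by (auto simp: power_bounded_def continuous_linear_operator_def)
  show "(dilation a ^^ m) ` S_omega \<omega> \<subseteq> Schwartz"
    using linear_into_funpow[OF lin] S_omega_subset_Schwartz by blast
  show "equicontinuous (S_omega \<omega>) (S_omega_seminorms \<omega>) Schwartz_seminorms {dilation a ^^ m | m. m \<ge> 1}"
    unfolding equicontinuous_def
  proof (intro ballI allI impI)
    fix f s and e :: real
    assume f: "f \<in> S_omega \<omega>" and s: "s \<in> Schwartz_seminorms" and e: "e > 0"
    obtain q n where s: "s = p_Schwartz q n" using s by (auto simp: Schwartz_seminorms_def)
    define K where "K = exp (young_conj \<omega> (real (n + q)))"
    have K: "K > 0" by (simp add: K_def)
    have p1: "p_omega \<omega> 1 \<in> S_omega_seminorms \<omega>" and eK: "e / K > 0"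
      using e K by (auto simp: S_omega_seminorms_def)
    from equi[unfolded equicontinuous_def, rule_format, OF f p1 eK]
    obtain P0 d where P0: "P0 \<subseteq> S_omega_seminorms \<omega>" "finite P0" "d > 0"
      and small: "\<And>U g. U \<in> {dilation a ^^ m | m. m \<ge> 1} \<Longrightarrow> g \<in> S_omega \<omega> \<Longrightarrow> (\<forall>p\<in>P0. p (\<lambda>x. g x - f x) < d) \<Longrightarrow>
        p_omega \<omega> 1 (\<lambda>x. U g x - U f x) < e / K"
      by blast
    have "s (\<lambda>x. U g x - U f x) < e"
      if U: "U \<in> {dilation a ^^ m | m. m \<ge> 1}" and g: "g \<in> S_omega \<omega>" "\<forall>p\<in>P0. p (\<lambda>x. g x - f x) < d" for U g
    proof -
      have "(\<lambda>x. U g x - U f x) \<in> S_omega \<omega>"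
        using U by (auto intro!: S_omega_diff linear_into_funpow[OF lin g(1)] linear_into_funpow[OF lin f])
      then have "s (\<lambda>x. U g x - U f x) \<le> K * p_omega \<omega> 1 (\<lambda>x. U g x - U f x)"
        unfolding s K_def by (rule p_Schwartz_le_p_omega)
      also have "\<dots> < e"
        using small[OF U g] K by (simp add: pos_less_divide_eq mult.commute)
      finally show ?thesis .
    qed
    with P0 show "\<exists>P0\<subseteq>S_omega_seminorms \<omega>. finite P0 \<and> (\<exists>d>0. \<forall>U\<in>{dilation a ^^ m | m. m \<ge> 1}. \<forall>g\<in>S_omega \<omega>.
      (\<forall>p\<in>P0. p (\<lambda>x. g x - f x) < d) \<longrightarrow> s (\<lambda>x. U g x - U f x) < e)" by blast
  qed
qed

section \<open>Necessity of |a| = 1\<close>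

lemma topologizable_imp_unit:
  assumes weight: "weight_function \<omega>" and a: "a \<noteq> 0"
    and zeta: "zeta_condition \<omega>"
    and top: "topologizable (S_omega \<omega>) (S_omega_seminorms \<omega>) (dilation a)"
  shows "a = 1 \<or> a = -1"
proof -
  have lin: "linear_into (S_omega \<omega>) (S_omega \<omega>) (dilation a)"
    using top by (simp add: topologizable_def continuous_linear_operator_def)
  have "p_omega \<omega> 1 \<in> S_omega_seminorms \<omega>" by (auto simp: S_omega_seminorms_def)
  then obtain \<mu> where \<mu>: "\<mu> > 0" and M: "\<And>k. k \<ge> 1 \<Longrightarrow>
      \<exists>M>0. \<forall>f\<in>S_omega \<omega>. p_omega \<omega> 1 ((dilation a ^^ k) f) \<le> M * p_omega \<omega> \<mu> f"
    using top unfolding topologizable_def S_omega_seminorms_def by blast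
  \<comment> \<open>Topologizability fixes \<mu> before k. Hence \<kappa> is the same for all
    iterates and only M varies with k, the order of quantifiers that
    \<open>weight_dilation_growth\<close> requires.\<close>
  obtain C \<kappa> where C: "C > 0" "\<kappa> \<ge> 0"
    "\<And>\<xi> \<eta>. \<xi> \<ge> 0 \<Longrightarrow> \<eta> \<ge> 0 \<Longrightarrow> \<xi> + \<eta> \<ge> 1 \<Longrightarrow>
      p_omega \<omega> \<mu> (gauss_wave \<xi> \<eta> 0) \<le> C * exp (\<kappa> * \<omega> (\<xi> + \<eta>))"
    using p_omega_gauss_wave[OF weight \<mu>] by blast
  have upper: "\<exists>M. \<forall>\<xi>\<ge>0. \<forall>\<eta>\<ge>0. \<xi> + \<eta> \<ge> 1 \<longrightarrow> (\<forall>z.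
      S_omega_term \<omega> 1 (\<lambda>x. gauss_wave \<xi> \<eta> 0 (a ^ k * x)) z \<le> M * exp (\<kappa> * \<omega> (\<xi> + \<eta>)))"
    if k: "k \<ge> 1" for k
  proof -
    obtain M where M: "M > 0" "\<And>f. f \<in> S_omega \<omega> \<Longrightarrow> p_omega \<omega> 1 ((dilation a ^^ k) f) \<le> M * p_omega \<omega> \<mu> f"
      using M[OF k] by blast
    have "S_omega_term \<omega> 1 (\<lambda>x. gauss_wave \<xi> \<eta> 0 (a ^ k * x)) z \<le> M * C * exp (\<kappa> * \<omega> (\<xi> + \<eta>))"
      if r: "\<xi> \<ge> 0" "\<eta> \<ge> 0" "\<xi> + \<eta> \<ge> 1" for \<xi> \<eta> z
    proof -
      note g = gauss_wave_in_S_omega[OF weight r]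
      have "S_omega_term \<omega> 1 ((dilation a ^^ k) (gauss_wave \<xi> \<eta> 0)) z \<le> p_omega \<omega> 1 ((dilation a ^^ k) (gauss_wave \<xi> \<eta> 0))"
        by (intro S_omega_term_le_p_omega linear_into_funpow[OF lin g]) auto
      also have "\<dots> \<le> M * p_omega \<omega> \<mu> (gauss_wave \<xi> \<eta> 0)" by (rule M(2)[OF g])
      also have "\<dots> \<le> M * (C * exp (\<kappa> * \<omega> (\<xi> + \<eta>)))"
        using M(1) r by (intro mult_left_mono C(3)) auto
      finally show ?thesis by (simp add: dilation_funpow mult.assoc)
    qed
    then show ?thesis by blast
  qed
  have "\<not> \<bar>a\<bar> > 1"
  proof
    assume a1: "\<bar>a\<bar> > 1"
    show False
    proof (rule weight_dilation_growth[OF weight zeta a1 C(2)])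
      fix k :: nat assume "k \<ge> 1"
      from upper[OF this] obtain M where M: "\<And>\<xi> \<eta> z. \<xi> \<ge> 0 \<Longrightarrow> \<eta> \<ge> 0 \<Longrightarrow> \<xi> + \<eta> \<ge> 1 \<Longrightarrow>
          S_omega_term \<omega> 1 (\<lambda>x. gauss_wave \<xi> \<eta> 0 (a ^ k * x)) z \<le> M * exp (\<kappa> * \<omega> (\<xi> + \<eta>))"
        by blast
      show "\<exists>M. \<forall>r\<ge>1. exp (\<omega> (\<bar>a\<bar> ^ k * r)) / (\<bar>a\<bar> ^ k * r) \<le> M * exp (\<kappa> * \<omega> r)"
      proof (intro exI[of _ M] allI impI)
        fix r :: real assume r: "r \<ge> 1"
        have "\<bar>a\<bar> ^ k * r \<ge> 1" using mult_mono[of 1 "\<bar>a\<bar> ^ k" 1 r] a1 r by simp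
        from ex_power_young_conj_ge[OF weight this] obtain n where
          n: "exp (\<omega> (\<bar>a\<bar> ^ k * r)) / (\<bar>a\<bar> ^ k * r) \<le> (\<bar>a\<bar> ^ k * r) ^ n * exp (- young_conj \<omega> (real n))" by blast
        \<comment> \<open>The frequency r contributes r^n at the origin and the chain rule
          contributes |a|^(k n), so the test point is x = 0 with q = 0.\<close>
        also have "\<dots> \<le> (\<bar>a\<bar> ^ k) ^ n * norm (gauss_wave r 0 n 0) * exp (- young_conj \<omega> (real n))"
          unfolding power_mult_distrib using r
          by (intro mult_right_mono mult_left_mono norm_gauss_wave_origin) auto
        also have "\<dots> = S_omega_term \<omega> 1 (\<lambda>x. gauss_wave r 0 0 (a ^ k * x)) (0, n, 0)"
          by (simp add: S_omega_term_def nderiv_scale[OF smooth_gauss_wave] nderiv_gauss_wave norm_mult norm_power)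
        also have "\<dots> \<le> M * exp (\<kappa> * \<omega> r)" using M[of r 0] r by simp
        finally show "exp (\<omega> (\<bar>a\<bar> ^ k * r)) / (\<bar>a\<bar> ^ k * r) \<le> M * exp (\<kappa> * \<omega> r)" .
      qed
    qed
  qed
  moreover have "\<not> \<bar>a\<bar> < 1"
  proof
    assume a1: "\<bar>a\<bar> < 1"
    define b where "b = 1 / \<bar>a\<bar>"
    have b: "b > 1" using a a1 by (simp add: b_def)
    show False
    proof (rule weight_dilation_growth[OF weight zeta b C(2)])
      fix k :: nat assume "k \<ge> 1"
      from upper[OF this] obtain M where M: "\<And>\<xi> \<eta> z. \<xi> \<ge> 0 \<Longrightarrow> \<eta> \<ge> 0 \<Longrightarrow> \<xi> + \<eta> \<ge> 1 \<Longrightarrow>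
          S_omega_term \<omega> 1 (\<lambda>x. gauss_wave \<xi> \<eta> 0 (a ^ k * x)) z \<le> M * exp (\<kappa> * \<omega> (\<xi> + \<eta>))"
        by blast
      show "\<exists>M. \<forall>r\<ge>1. exp (\<omega> (b ^ k * r)) / (b ^ k * r) \<le> M * exp (\<kappa> * \<omega> r)"
      proof (intro exI[of _ M] allI impI)
        fix r :: real assume r: "r \<ge> 1"
        have "b ^ k * r \<ge> 1" using mult_mono[of 1 "b ^ k" 1 r] b r by simp
        from ex_power_young_conj_ge[OF weight this] obtain q where
          q: "exp (\<omega> (b ^ k * r)) / (b ^ k * r) \<le> (b ^ k * r) ^ q * exp (- young_conj \<omega> (real q))" by blast
        \<comment> \<open>The dilated Gaussian is centred at r / a^k, where its modulus is 1 and the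
          polynomial weight exceeds (b^k r)^q.\<close>
        also have "\<dots> \<le> (1 + \<bar>r / a ^ k\<bar>) ^ q * exp (- young_conj \<omega> (real q))"
          using r b by (intro mult_right_mono power_mono) (auto simp: b_def power_divide power_abs)
        also have "\<dots> = S_omega_term \<omega> 1 (\<lambda>x. gauss_wave 0 r 0 (a ^ k * x)) (r / a ^ k, 0, q)"
          using a norm_gauss_wave_center[of 0 r] by (simp add: S_omega_term_def)
        also have "\<dots> \<le> M * exp (\<kappa> * \<omega> r)" using M[of 0 r] r by simp
        finally show "exp (\<omega> (b ^ k * r)) / (b ^ k * r) \<le> M * exp (\<kappa> * \<omega> r)" .
      qed
    qed
  qed
  ultimately show ?thesis by linarith
qed

text \<open>If |a| > 1, the first derivative at 0 of the iterates grows at least like |a|^m. If |a|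
  < 1, the centre of the Gaussian moves out to 1 / a^m, where the weight 1 + |x| is at least
  |a|^(-m).\<close>

lemma equicontinuous_Schwartz_imp_unit:
  assumes weight: "weight_function \<omega>" and a: "a \<noteq> 0"
    and maps: "\<And>m. m \<ge> 1 \<Longrightarrow> (dilation a ^^ m) ` S_omega \<omega> \<subseteq> Schwartz"
    and equi: "equicontinuous (S_omega \<omega>) (S_omega_seminorms \<omega>) Schwartz_seminorms {dilation a ^^ m | m. m \<ge> 1}"
  shows "a = 1 \<or> a = -1"
proof -
  have unbounded: False if b: "b > 1" and B: "\<And>m. m \<ge> 1 \<Longrightarrow> b ^ m \<le> B" for b B :: real
  proof -
    obtain m where m: "B < b ^ m" using real_arch_pow[OF b] by blast
    also have "\<dots> \<le> b ^ Suc m" using b by (intro power_increasing) auto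
    finally show False using B[of "Suc m"] by simp
  qed
  have "\<not> \<bar>a\<bar> > 1"
  proof
    assume a1: "\<bar>a\<bar> > 1"
    have "gauss_wave 1 0 0 \<in> S_omega \<omega>" by (rule gauss_wave_in_S_omega[OF weight]) auto
    from equicontinuous_Schwartz_bounded[OF maps equi this, of 0 1]
    obtain B where B: "\<And>m x. m \<ge> 1 \<Longrightarrow> (1 + \<bar>x\<bar>) ^ 0 * norm (nderiv 1 (\<lambda>x. gauss_wave 1 0 0 (a ^ m * x)) x) \<le> B"
      by blast
    show False
    proof (rule unbounded[OF a1])
      fix m :: nat assume "m \<ge> 1"
      have "\<bar>a\<bar> ^ m * 1 ^ 1 \<le> \<bar>a\<bar> ^ m * norm (gauss_wave 1 0 1 0)"
        by (intro mult_left_mono norm_gauss_wave_origin) auto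
      also have "\<dots> \<le> B"
        using B[OF \<open>m \<ge> 1\<close>, of 0]
        by (simp add: nderiv_scale[OF smooth_gauss_wave] nderiv_gauss_wave norm_mult norm_power)
      finally show "\<bar>a\<bar> ^ m \<le> B" by simp
    qed
  qed
  moreover have "\<not> \<bar>a\<bar> < 1"
  proof
    assume a1: "\<bar>a\<bar> < 1"
    have "gauss_wave 0 1 0 \<in> S_omega \<omega>" by (rule gauss_wave_in_S_omega[OF weight]) auto
    from equicontinuous_Schwartz_bounded[OF maps equi this, of 1 0]
    obtain B where B: "\<And>m x. m \<ge> 1 \<Longrightarrow> (1 + \<bar>x\<bar>) ^ 1 * norm (nderiv 0 (\<lambda>x. gauss_wave 0 1 0 (a ^ m * x)) x) \<le> B"
      by blast
    show False
    proof (rule unbounded[of "1 / \<bar>a\<bar>"])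
      fix m :: nat assume "m \<ge> 1"
      have "(1 / \<bar>a\<bar>) ^ m \<le> 1 + \<bar>1 / a ^ m\<bar>" by (simp add: power_divide power_abs)
      also have "\<dots> \<le> B"
        using B[OF \<open>m \<ge> 1\<close>, of "1 / a ^ m"] a norm_gauss_wave_center[of 0 1] by simp
      finally show "(1 / \<bar>a\<bar>) ^ m \<le> B" .
    qed (use a a1 in simp)
  qed
  ultimately show ?thesis by linarith
qed

section \<open>The equivalence of the five conditions\<close>

theorem theorem3p11:
  fixes \<omega> \<psi> :: "real \<Rightarrow> real" and a :: real
  assumes "weight_function \<omega>"
    and "\<forall>x. \<psi> x = a * x"
    and "a \<noteq> 0"
    and "zeta_condition \<omega>"
  shows
    "(power_bounded (S_omega \<omega>) (S_omega_seminorms \<omega>) (comp_op \<psi>)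
        \<longleftrightarrow> m_topologizable (S_omega \<omega>) (S_omega_seminorms \<omega>) (comp_op \<psi>)) \<and>
     (m_topologizable (S_omega \<omega>) (S_omega_seminorms \<omega>) (comp_op \<psi>)
        \<longleftrightarrow> topologizable (S_omega \<omega>) (S_omega_seminorms \<omega>) (comp_op \<psi>)) \<and>
     (topologizable (S_omega \<omega>) (S_omega_seminorms \<omega>) (comp_op \<psi>)
        \<longleftrightarrow> (\<forall>m\<ge>1. linear_into (S_omega \<omega>) Schwartz (comp_op (\<psi> ^^ m))) \<and>
          equicontinuous (S_omega \<omega>) (S_omega_seminorms \<omega>) Schwartz_seminorms
            {comp_op (\<psi> ^^ m) | m. m \<ge> 1}) \<and>
     ((\<forall>m\<ge>1. linear_into (S_omega \<omega>) Schwartz (comp_op (\<psi> ^^ m))) \<and>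
          equicontinuous (S_omega \<omega>) (S_omega_seminorms \<omega>) Schwartz_seminorms
            {comp_op (\<psi> ^^ m) | m. m \<ge> 1}
        \<longleftrightarrow> a = 1 \<or> a = -1)"
proof -
  have psi: "\<psi> = (\<lambda>x. a * x)" using assms(2) by auto
  note ctx = assms(1,3)
  let ?C = "comp_op \<psi>"
  let ?pb = "power_bounded (S_omega \<omega>) (S_omega_seminorms \<omega>) ?C"
  let ?mt = "m_topologizable (S_omega \<omega>) (S_omega_seminorms \<omega>) ?C"
  let ?t = "topologizable (S_omega \<omega>) (S_omega_seminorms \<omega>) ?C"
  let ?eq = "(\<forall>m\<ge>1. linear_into (S_omega \<omega>) Schwartz (comp_op (\<psi> ^^ m))) \<and>
          equicontinuous (S_omega \<omega>) (S_omega_seminorms \<omega>) Schwartz_seminorms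
            {comp_op (\<psi> ^^ m) | m. m \<ge> 1}"
  have eq: "?eq \<longleftrightarrow> (\<forall>m\<ge>1. (?C ^^ m) ` S_omega \<omega> \<subseteq> Schwartz) \<and>
      equicontinuous (S_omega \<omega>) (S_omega_seminorms \<omega>) Schwartz_seminorms {?C ^^ m | m. m \<ge> 1}"
    by (simp only: linear_into_comp_op comp_op_funpow)
  \<comment> \<open>All conditions are tied to (5): it implies (1) and (2), and the chains from (2)
    to (3) to (5) and from (1) to (4) to (5) lead back.\<close>
  have 1: "a = 1 \<or> a = -1 \<Longrightarrow> ?pb" and 2: "a = 1 \<or> a = -1 \<Longrightarrow> ?mt"
    unfolding psi by (rule unit_imp_power_bounded unit_imp_m_topologizable; assumption)+
  have 3: "?mt \<Longrightarrow> ?t" by (rule m_topologizable_imp_topologizable)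
  have 4: "?t \<Longrightarrow> a = 1 \<or> a = -1"
    unfolding psi by (rule topologizable_imp_unit[OF ctx assms(4)])
  have 5: "?pb \<Longrightarrow> ?eq"
    unfolding eq unfolding psi using power_bounded_imp_equicontinuous_Schwartz by blast
  have 6: "?eq \<Longrightarrow> a = 1 \<or> a = -1"
    unfolding eq unfolding psi using equicontinuous_Schwartz_imp_unit[OF ctx] by blast
  from 1 2 3 4 5 6 show ?thesis by blast
qed

end
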